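(* Suppose $S\in H^2_{st}$, with $S=\nabla_{sym}u$ and $\omega=\nabla\times u$. Then $$\left\langle-\Delta S,\omega\otimes\omega\right\rangle=0 .$$
   Context: All functions are on $\mathbb{R}^3$. For a vector field $v$, $(\nabla_{sym}v)_{ij}=\frac12(\partial_iv_j+\partial_jv_i)$. $\dot H^1_{df}$ is the space of divergence free vector fields $u:\mathbb{R}^3\to\mathbb{R}^3$ in $\dot H^1$. The space of strain matrices is $L^2_{st}=\{\nabla_{sym}u:u\in\dot H^1_{df}\}$, and $H^2_{st}=L^2_{st}\cap H^2$. In the claim $u\in\dot H^1_{df}$ is the divergence free vector field with $S=\nabla_{sym}u$ (namely $u=-2\operatorname{div}(-\Delta)^{-1}S$, where $(\operatorname{div}S)_i=\sum_j\partial_jS_{ij}$). $(\omega\otimes\omega)_{ij}=\omega_i\omega_j$, and $\langle A,B\rangle=\int_{\mathbb{R}^3}\sum_{i,j=1}^3A_{ij}B_{ij}\,dx$ is the $L^2$ inner product of matrix-valued functions. *)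

theory Defs
  imports "HOL-Analysis.Analysis"
begin

type_synonym R3 = "real^3"

text \<open>
  Functions in Lebesgue and Sobolev spaces are represented by Borel functions on the whole space,
  and equality between elements of such spaces is equality almost everywhere.
\<close>

section \<open>Test functions\<close>

definition partial :: "3 \<Rightarrow> (R3 \<Rightarrow> real) \<Rightarrow> R3 \<Rightarrow> real" where
  "partial i f x = frechet_derivative f (at x) (axis i 1)"

text \<open>A function all of whose iterated partial derivatives are (Frechet) differentiable everywhere
  has continuous partial derivatives of every order, and conversely.\<close>

definition smooth :: "(R3 \<Rightarrow> real) \<Rightarrow> bool" where
  "smooth f \<longleftrightarrow> (\<forall>is. foldr partial is f differentiable_on UNIV)"

definition test_function :: "(R3 \<Rightarrow> real) \<Rightarrow> bool" where
  "test_function \<phi> \<longleftrightarrow> smooth \<phi> \<and> compact (closure {x. \<phi> x \<noteq> 0})"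

section \<open>Weak derivatives\<close>

definition locally_integrable :: "(R3 \<Rightarrow> real) \<Rightarrow> bool" where
  "locally_integrable f \<longleftrightarrow>
     f \<in> borel_measurable borel \<and> (\<forall>K. compact K \<longrightarrow> set_integrable lborel K f)"

definition is_weak_partial :: "3 \<Rightarrow> (R3 \<Rightarrow> real) \<Rightarrow> (R3 \<Rightarrow> real) \<Rightarrow> bool" where
  "is_weak_partial i f g \<longleftrightarrow> locally_integrable f \<and> locally_integrable g \<and>
     (\<forall>\<phi>. test_function \<phi> \<longrightarrow>
        (LINT x|lborel. f x * partial i \<phi> x) = - (LINT x|lborel. g x * \<phi> x))"

text \<open>The weak derivative is unique only up to null sets; \<open>weak_partial i f\<close> is a chosen
  representative, and is meaningful only if a weak derivative exists.\<close>

definition weak_partial :: "3 \<Rightarrow> (R3 \<Rightarrow> real) \<Rightarrow> R3 \<Rightarrow> real" where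
  "weak_partial i f = (SOME g. is_weak_partial i f g)"

section \<open>Function spaces\<close>

definition L2 :: "(R3 \<Rightarrow> real) set" where
  "L2 = {f. f \<in> borel_measurable borel \<and> integrable lborel (\<lambda>x. (f x)\<^sup>2)}"

definition H1 :: "(R3 \<Rightarrow> real) set" where
  "H1 = {f \<in> L2. \<forall>i. \<exists>g\<in>L2. is_weak_partial i f g}"

definition H2 :: "(R3 \<Rightarrow> real) set" where
  "H2 = {f \<in> H1. \<forall>i. \<exists>g\<in>H1. is_weak_partial i f g}"

text \<open>The homogeneous space is the completion of the test functions in the norm
  \<open>\<phi> \<mapsto> \<parallel>\<nabla>\<phi>\<parallel>\<close> of \<open>L2\<close>. In dimension three Gagliardo-Nirenberg-Sobolev realizes this completion
  as a space of locally integrable functions (nonzero constants do not belong to it): the limits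
  in local \<open>L1\<close> of sequences of test functions whose gradients converge in \<open>L2\<close>.\<close>

definition Hdot1 :: "(R3 \<Rightarrow> real) set" where
  "Hdot1 = {f. (\<forall>i. \<exists>g\<in>L2. is_weak_partial i f g) \<and>
     (\<exists>\<phi>::nat \<Rightarrow> R3 \<Rightarrow> real. (\<forall>n. test_function (\<phi> n)) \<and>
        (\<forall>K. compact K \<longrightarrow> (\<lambda>n. LINT x:K|lborel. \<bar>\<phi> n x - f x\<bar>) \<longlonglongrightarrow> 0) \<and>
        (\<forall>i. (\<lambda>n. LINT x|lborel. (partial i (\<phi> n) x - weak_partial i f x)\<^sup>2) \<longlonglongrightarrow> 0))}"

section \<open>Vector and matrix fields\<close>

definition divergence :: "(R3 \<Rightarrow> real^3) \<Rightarrow> R3 \<Rightarrow> real" where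
  "divergence u x = (\<Sum>i\<in>UNIV. weak_partial i (\<lambda>y. u y $ i) x)"

definition curl :: "(R3 \<Rightarrow> real^3) \<Rightarrow> R3 \<Rightarrow> real^3" where
  "curl u x = vector
     [weak_partial 2 (\<lambda>y. u y $ 3) x - weak_partial 3 (\<lambda>y. u y $ 2) x,
      weak_partial 3 (\<lambda>y. u y $ 1) x - weak_partial 1 (\<lambda>y. u y $ 3) x,
      weak_partial 1 (\<lambda>y. u y $ 2) x - weak_partial 2 (\<lambda>y. u y $ 1) x]"

definition sym_grad :: "(R3 \<Rightarrow> real^3) \<Rightarrow> R3 \<Rightarrow> real^3^3" where
  "sym_grad u x = (\<chi> i j.
     (1/2) * (weak_partial i (\<lambda>y. u y $ j) x + weak_partial j (\<lambda>y. u y $ i) x))"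

definition laplacian :: "(R3 \<Rightarrow> real^3^3) \<Rightarrow> R3 \<Rightarrow> real^3^3" where
  "laplacian S x = (\<chi> i j.
     \<Sum>k\<in>UNIV. weak_partial k (weak_partial k (\<lambda>y. S y $ i $ j)) x)"

definition tensor :: "real^3 \<Rightarrow> real^3 \<Rightarrow> real^3^3" where
  "tensor v w = (\<chi> i j. v $ i * w $ j)"

text \<open>On \<open>real^3^3\<close> the library inner product \<open>\<bullet>\<close> is the entrywise (Frobenius) one. The integral
  is only meaningful if the integrand is integrable.\<close>

definition L2_inner :: "(R3 \<Rightarrow> real^3^3) \<Rightarrow> (R3 \<Rightarrow> real^3^3) \<Rightarrow> real" where
  "L2_inner A B = (LINT x|lborel. A x \<bullet> B x)"

definition Hdot1_df :: "(R3 \<Rightarrow> real^3) set" where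
  "Hdot1_df = {u. (\<forall>i. (\<lambda>x. u x $ i) \<in> Hdot1) \<and> (AE x in lborel. divergence u x = 0)}"

definition L2_st :: "(R3 \<Rightarrow> real^3^3) set" where
  "L2_st = {S \<in> borel_measurable borel. \<exists>u\<in>Hdot1_df. AE x in lborel. S x = sym_grad u x}"

definition H2_st :: "(R3 \<Rightarrow> real^3^3) set" where
  "H2_st = L2_st \<inter> {S. \<forall>i j. (\<lambda>x. S x $ i $ j) \<in> H2}"

end

theory Submission
  imports Defs
begin

text \<open>
  The strain determines the second derivatives of the velocity, by
  \<open>\<partial>\<^sub>j\<partial>\<^sub>k u\<^sub>i = \<partial>\<^sub>j S\<^sub>i\<^sub>k + \<partial>\<^sub>k S\<^sub>i\<^sub>j - \<partial>\<^sub>i S\<^sub>j\<^sub>k\<close>, so that the gradient of \<open>u\<close> and the vorticity \<open>\<omega>\<close> lie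
  in \<open>H2\<close>. Since \<open>- \<Delta>u = w\<close> with \<open>w = curl \<omega>\<close>, the integrand is \<open>\<Sum>\<^sub>i\<^sub>j \<partial>\<^sub>i w\<^sub>j \<omega>\<^sub>i \<omega>\<^sub>j\<close>, and as \<open>\<omega>\<close>
  and \<open>w\<close> are divergence free and \<open>w \<bullet> (w \<times> \<omega>) = 0\<close> it equals the divergence of
  \<open>(w \<bullet> \<omega>) \<omega> - \<bar>\<omega>\<bar>\<^sup>2 w / 2\<close>. The integrals converge because \<open>\<omega>\<close> and \<open>w\<close> are in \<open>H1\<close>, hence in
  \<open>L4\<close>. Integration by parts needs no approximation by smooth functions: a function with a weak partial derivative
  is absolutely continuous on almost every line in that direction, and this property passes
  to products.
\<close>

section \<open>Smooth functions\<close>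

text \<open>Only the gradient of \<open>u\<close> is known to be square integrable, so
  \<open>u\<close> itself enters through weak derivatives alone, and every product is formed from
  \<open>U\<close>, the vorticity \<omega> and \<open>w\<close>. The regularity is tight at one
  place: \<open>w\<close> lies merely in \<open>H1\<close>, so its gradient is a bare L2 factor and
  the two vorticity factors beside it must together supply L2. The L4 bound pays for this; after
  expansion every term has one factor in L2 and two in \<open>H1\<close>. The vector field is found
  by moving the derivative off \<open>w\<close>. This leaves w . (\<omega> . grad) \<omega>, and
  (\<omega> . grad) \<omega> is the gradient of |\<omega>|^2 / 2 plus w \<times> \<omega>. The cross
  product is orthogonal to \<open>w\<close>, and what is left is again a divergence because
  \<open>w\<close> is divergence free. Working along lines also settles the boundary terms: an
  integrable function and its translate have the same integral, so neither decay at infinity nor a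
  cutoff enters.\<close>

lemma partial_eqI: "(f has_derivative f') (at x) \<Longrightarrow> partial i f x = f' (axis i 1)"
  unfolding partial_def by (simp add: frechet_derivative_at[symmetric])

lemma partial_mult:
  assumes "f differentiable (at x)" "g differentiable (at x)"
  shows "partial i (\<lambda>x. f x * g x) x = partial i f x * g x + f x * partial i g x"
proof -
  from assms have "(f has_derivative frechet_derivative f (at x)) (at x)"
    "(g has_derivative frechet_derivative g (at x)) (at x)"
    by (auto simp: frechet_derivative_works)
  from partial_eqI[OF has_derivative_mult[OF this], of i] show ?thesis
    by (simp add: partial_def add.commute)
qed

lemma partial_add:
  assumes "f differentiable (at x)" "g differentiable (at x)"
  shows "partial i (\<lambda>x. f x + g x) x = partial i f x + partial i g x"
proof -
  from assms have "(f has_derivative frechet_derivative f (at x)) (at x)"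
    "(g has_derivative frechet_derivative g (at x)) (at x)"
    by (auto simp: frechet_derivative_works)
  from partial_eqI[OF has_derivative_add[OF this], of i] show ?thesis
    by (simp add: partial_def)
qed

lemma partial_compose_real:
  assumes "f differentiable (at x)" "(g has_real_derivative D) (at (f x))"
  shows "partial i (\<lambda>x. g (f x)) x = D * partial i f x"
proof -
  from assms have "(f has_derivative frechet_derivative f (at x)) (at x)"
    by (auto simp: frechet_derivative_works)
  from partial_eqI[OF has_derivative_compose[OF this, of g "\<lambda>y. D * y"], of i] assms(2)
  show ?thesis
    by (simp add: partial_def has_field_derivative_def)
qed

lemma partial_const: "partial i (\<lambda>x. c) = (\<lambda>x. 0)"
  by (rule ext) (rule partial_eqI[OF has_derivative_const])

lemma has_derivative_coord: "((\<lambda>x::real^3. x $ i) has_derivative (\<lambda>h. h $ i)) (at x)"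
  by (rule bounded_linear_imp_has_derivative) (rule bounded_linear_vec_nth)

lemma differentiable_compose_real:
  fixes f :: "R3 \<Rightarrow> real"
  assumes "f differentiable (at x)" "(g has_real_derivative D) (at (f x))"
  shows "(\<lambda>x. g (f x)) differentiable (at x)"
proof -
  from assms have "(f has_derivative frechet_derivative f (at x)) (at x)"
    by (auto simp: frechet_derivative_works)
  from has_derivative_compose[OF this, of g "\<lambda>y. D * y"] assms(2)
  show ?thesis
    unfolding differentiable_def has_field_derivative_def by blast
qed

lemma partial_translate:
  assumes "f differentiable (at (x - a))"
  shows "(\<lambda>x. f (x - a)) differentiable (at x)"
    and "partial i (\<lambda>x. f (x - a)) x = partial i f (x - a)"
proof -
  have 1: "(f has_derivative frechet_derivative f (at (x - a))) (at (x - a))"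
    using assms by (auto simp: frechet_derivative_works)
  have "((\<lambda>x. x - a) has_derivative (\<lambda>h. h)) (at x)"
    by (auto intro!: derivative_eq_intros)
  from has_derivative_compose[OF this 1]
  have 2: "((\<lambda>x. f (x - a)) has_derivative frechet_derivative f (at (x - a))) (at x)" .
  then show "(\<lambda>x. f (x - a)) differentiable (at x)"
    unfolding differentiable_def by blast
  show "partial i (\<lambda>x. f (x - a)) x = partial i f (x - a)"
    by (simp add: partial_eqI[OF 2]) (simp add: partial_def)
qed

lemma partial_along_line:
  assumes "f differentiable (at (x + t *\<^sub>R axis i 1))"
  shows "((\<lambda>t. f (x + t *\<^sub>R axis i 1)) has_real_derivative partial i f (x + t *\<^sub>R axis i 1)) (at t)"
proof -
  let ?y = "x + t *\<^sub>R axis i 1"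
  have 1: "(f has_derivative frechet_derivative f (at ?y)) (at ?y)"
    using assms by (auto simp: frechet_derivative_works)
  have "((\<lambda>t. x + t *\<^sub>R axis i 1) has_derivative (\<lambda>h. h *\<^sub>R axis i 1)) (at t)"
    by (auto intro!: derivative_eq_intros)
  from has_derivative_compose[OF this 1]
  have 2: "((\<lambda>t. f (x + t *\<^sub>R axis i 1)) has_derivative (\<lambda>h. frechet_derivative f (at ?y) (h *\<^sub>R axis i 1))) (at t)" .
  have "(\<lambda>h. frechet_derivative f (at ?y) (h *\<^sub>R axis i 1)) = (*) (partial i f ?y)"
    using linear_scale[OF has_derivative_linear[OF 1]] by (auto simp: partial_def)
  with 2 show ?thesis
    by (simp add: has_field_derivative_def)
qed

text \<open>Derivatives of products and compositions branch into sums, which a list induction on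
  \<open>foldr partial\<close> does not follow. Bounding the order allows an induction on
  \<open>n\<close> with the functions left arbitrary, where \<open>partial i f\<close> is simply
  another function of order one less.\<close>

fun smooth_upto :: "nat \<Rightarrow> (R3 \<Rightarrow> real) \<Rightarrow> bool" where
  "smooth_upto 0 f \<longleftrightarrow> (\<forall>x. f differentiable (at x))"
| "smooth_upto (Suc n) f \<longleftrightarrow> (\<forall>x. f differentiable (at x)) \<and> (\<forall>i. smooth_upto n (partial i f))"

lemma smooth_upto_iff:
  "smooth_upto n f \<longleftrightarrow> (\<forall>is. length is \<le> n \<longrightarrow> foldr partial is f differentiable_on UNIV)"
proof (induction n arbitrary: f)
  case 0
  then show ?case by (simp add: differentiable_on_def)
next
  case (Suc n)
  show ?case (is "?L \<longleftrightarrow> ?R")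
  proof
    assume L: ?L
    show ?R
    proof (intro allI impI)
      fix ks :: "3 list" assume "length ks \<le> Suc n"
      \<comment> \<open>\<open>smooth_upto\<close> strips the derivative applied first, which is the
        last entry of the list; hence the list is taken apart from its end.\<close>
      then show "foldr partial ks f differentiable_on UNIV"
        using L Suc.IH by (cases ks rule: rev_cases) (auto simp: differentiable_on_def)
    qed
  next
    assume R: ?R
    have "smooth_upto n (partial i f)" for i
      unfolding Suc.IH
    proof (intro allI impI)
      fix ks :: "3 list" assume "length ks \<le> n"
      then show "foldr partial ks (partial i f) differentiable_on UNIV"
        using R[rule_format, of "ks @ [i]"] by simp
    qed
    then show ?L
      using R[rule_format, of "[]"] by (simp add: differentiable_on_def)
  qed
qed

lemma smooth_iff_smooth_upto: "smooth f \<longleftrightarrow> (\<forall>n. smooth_upto n f)"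
  unfolding smooth_def smooth_upto_iff by auto

lemma smooth_upto_differentiable: "smooth_upto n f \<Longrightarrow> f differentiable (at x)"
  by (cases n) auto

lemma smooth_upto_Suc: "smooth_upto (Suc n) f \<Longrightarrow> smooth_upto n f"
  unfolding smooth_upto_iff by auto

lemma smooth_differentiable: "smooth f \<Longrightarrow> f differentiable (at x)"
  by (meson smooth_iff_smooth_upto smooth_upto_differentiable)

lemma smooth_partial: "smooth f \<Longrightarrow> smooth (partial i f)"
  unfolding smooth_iff_smooth_upto by (metis smooth_upto.simps(2))

lemma smooth_continuous: "smooth f \<Longrightarrow> continuous_on A f"
  by (meson continuous_at_imp_continuous_on differentiable_imp_continuous_within
      smooth_differentiable)

lemma smooth_upto_add: "smooth_upto n f \<Longrightarrow> smooth_upto n g \<Longrightarrow> smooth_upto n (\<lambda>x. f x + g x)"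
proof (induction n arbitrary: f g)
  case 0
  then show ?case by simp
next
  case (Suc n)
  then have "partial i (\<lambda>x. f x + g x) = (\<lambda>x. partial i f x + partial i g x)" for i
    by (intro ext partial_add) auto
  with Suc show ?case by simp
qed

lemma smooth_upto_mult: "smooth_upto n f \<Longrightarrow> smooth_upto n g \<Longrightarrow> smooth_upto n (\<lambda>x. f x * g x)"
proof (induction n arbitrary: f g)
  case 0
  then show ?case by simp
next
  case (Suc n)
  then have "partial i (\<lambda>x. f x * g x) = (\<lambda>x. partial i f x * g x + f x * partial i g x)" for i
    by (intro ext partial_mult) auto
  moreover have "smooth_upto n f" "smooth_upto n g"
    using Suc.prems smooth_upto_Suc by blast+
  ultimately show ?case
    using Suc by (simp add: smooth_upto_add)
qed

lemma smooth_upto_const: "smooth_upto n (\<lambda>x. c)"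
  by (induction n arbitrary: c) (simp_all add: partial_const)

lemma smooth_const: "smooth (\<lambda>x. c)"
  by (simp add: smooth_iff_smooth_upto smooth_upto_const)

lemma smooth_add: "smooth f \<Longrightarrow> smooth g \<Longrightarrow> smooth (\<lambda>x. f x + g x)"
  by (simp add: smooth_iff_smooth_upto smooth_upto_add)

lemma smooth_mult: "smooth f \<Longrightarrow> smooth g \<Longrightarrow> smooth (\<lambda>x. f x * g x)"
  by (simp add: smooth_iff_smooth_upto smooth_upto_mult)

lemma smooth_prod: "(\<And>k. k \<in> A \<Longrightarrow> smooth (f k)) \<Longrightarrow> smooth (\<lambda>x. \<Prod>k\<in>A. f k x)"
  by (induction A rule: infinite_finite_induct) (simp_all add: smooth_const smooth_mult)

text \<open>The derivative is the same exponential times a smooth factor, so the induction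
  hypothesis for this one function is enough.\<close>

lemma smooth_exp:
  assumes "smooth f"
  shows "smooth (\<lambda>x. exp (f x))"
proof -
  have "smooth_upto n (\<lambda>x. exp (f x))" for n
  proof (induction n)
    case 0
    then show ?case
      by (auto intro!: differentiable_compose_real[OF smooth_differentiable[OF assms]] DERIV_exp)
  next
    case (Suc n)
    have "partial i (\<lambda>x. exp (f x)) = (\<lambda>x. exp (f x) * partial i f x)" for i
      by (intro ext partial_compose_real smooth_differentiable[OF assms] DERIV_exp)
    moreover have "smooth_upto n (partial i f)" for i
      using assms smooth_iff_smooth_upto smooth_partial by blast
    ultimately show ?case
      using Suc by (auto intro!: smooth_upto_mult
          differentiable_compose_real[OF smooth_differentiable[OF assms]] DERIV_exp)
  qed
  then show ?thesis
    by (simp add: smooth_iff_smooth_upto)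
qed

section \<open>A smooth function vanishing on a half-line\<close>

definition flat :: "real poly \<Rightarrow> real \<Rightarrow> real" where
  "flat p t = (if t > 0 then poly p (1 / t) * exp (- (1 / t)) else 0)"

lemma poly_exp_tendsto_0: "((\<lambda>t. poly p t * exp (- t)) \<longlongrightarrow> (0::real)) at_top"
proof -
  have "((\<lambda>t. \<Sum>i\<le>degree p. coeff p i * (t ^ i * exp (- t))) \<longlongrightarrow> (\<Sum>i\<le>degree p. coeff p i * 0)) at_top"
  proof (intro tendsto_sum tendsto_mult tendsto_const)
    fix i
    show "((\<lambda>t::real. t ^ i * exp (- t)) \<longlongrightarrow> 0) at_top"
      using tendsto_power_div_exp_0[of i] by (simp add: exp_minus divide_inverse)
  qed
  then show ?thesis
    by (simp add: poly_altdef sum_distrib_right mult.assoc)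
qed

text \<open>With s = 1/t the chain rule contributes s^2 and the product rule p - p', so the family
  is closed under differentiation. Smoothness of exp(-1/t), the case p = 1, thereby reduces to first
  derivatives.\<close>

lemma flat_deriv:
  "(flat p has_real_derivative flat ([:0, 0, 1:] * (p - pderiv p)) t) (at t)"
proof -
  let ?q = "[:0, 0, 1:] * (p - pderiv p)"
  consider "t > 0" | "t < 0" | "t = 0" by linarith
  then show ?thesis
  proof cases
    case 1
    have "((\<lambda>t. poly p (1 / t) * exp (- (1 / t))) has_real_derivative
       poly ?q (1 / t) * exp (- (1 / t))) (at t)"
      using 1 by (auto intro!: derivative_eq_intros DERIV_chain2[OF poly_DERIV]
          simp: field_simps power2_eq_square)
    then have "(flat p has_real_derivative poly ?q (1 / t) * exp (- (1 / t))) (at t)"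
      by (rule has_field_derivative_transform_within_open[where S="{0<..}"])
         (use 1 in \<open>auto simp: flat_def\<close>)
    then show ?thesis using 1 by (simp add: flat_def)
  next
    case 2
    have "(flat p has_real_derivative 0) (at t)"
      by (rule has_field_derivative_transform_within_open[where S="{..<0}" and f="\<lambda>_. 0"])
         (use 2 in \<open>auto simp: flat_def\<close>)
    then show ?thesis using 2 by (simp add: flat_def)
  next
    case 3
    \<comment> \<open>For h > 0 the difference quotient belongs to the polynomial X p, and it tends
      to 0 because the exponential dominates every polynomial in 1/h.\<close>
    have R: "((\<lambda>h. flat p h / h) \<longlongrightarrow> 0) (at_right 0)"
    proof -
      have "((\<lambda>h. poly ([:0,1:] * p) (1/h) * exp (- (1/h))) \<longlongrightarrow> 0) (at_right (0::real))"
        by (rule filterlim_compose[OF poly_exp_tendsto_0])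
           (auto intro: filterlim_inverse_at_top_right simp flip: inverse_eq_divide)
      then show ?thesis
        by (rule Lim_transform_eventually)
           (auto simp: flat_def eventually_at_filter)
    qed
    have L: "((\<lambda>h. flat p h / h) \<longlongrightarrow> 0) (at_left 0)"
      by (rule tendsto_eventually) (auto simp: flat_def eventually_at_filter)
    have "((\<lambda>h. flat p h / h) \<longlongrightarrow> 0) (at 0)"
      using L R by (simp add: filterlim_split_at)
    then show ?thesis using 3 by (simp add: has_field_derivative_iff flat_def)
  qed
qed

lemma smooth_flat_coord: "smooth (\<lambda>x. flat p (c * x $ i + d))"
proof -
  have der: "((\<lambda>y. flat p (c * y + d)) has_real_derivative
      c * flat ([:0, 0, 1:] * (p - pderiv p)) (c * y + d)) (at y)" for p y
  proof -
    have "((\<lambda>y. c * y + d) has_real_derivative c) (at y)"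
      by (auto intro!: derivative_eq_intros)
    from DERIV_chain2[OF flat_deriv this] show ?thesis by (simp add: mult.commute)
  qed
  have co: "(\<lambda>x::R3. x $ i) differentiable (at x)" for x
    using has_derivative_coord differentiable_def by blast
  have di: "(\<lambda>x::R3. flat p (c * x $ i + d)) differentiable (at x)" for x p
    by (rule differentiable_compose_real[OF co der])
  have "smooth_upto n (\<lambda>x. flat p (c * x $ i + d))" for n
  proof (induction n arbitrary: p)
    case 0
    then show ?case using di by simp
  next
    case (Suc n)
    have "partial j (\<lambda>x. flat p (c * x $ i + d)) = (\<lambda>x. (if j = i then c else 0) *
        flat ([:0, 0, 1:] * (p - pderiv p)) (c * x $ i + d))" for j
    proof
      fix x :: R3
      have "partial j (\<lambda>x. x $ i) x = (if j = i then 1 else 0)"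
        by (simp add: partial_eqI[OF has_derivative_coord] axis_def)
      then show "partial j (\<lambda>x. flat p (c * x $ i + d)) x = (if j = i then c else 0) *
        flat ([:0, 0, 1:] * (p - pderiv p)) (c * x $ i + d)"
        using partial_compose_real[OF co der] by simp
    qed
    then show ?case using Suc di smooth_upto_mult[OF smooth_upto_const Suc] by simp
  qed
  then show ?thesis by (simp add: smooth_iff_smooth_upto)
qed

section \<open>Test functions\<close>

lemma test_functionI:
  assumes "smooth \<phi>" "bounded K" "\<And>x. \<phi> x \<noteq> 0 \<Longrightarrow> x \<in> K"
  shows "test_function \<phi>"
  unfolding test_function_def compact_eq_bounded_closed
  using assms by (auto intro!: bounded_closure bounded_subset[of K])

lemma test_function_smooth: "test_function \<phi> \<Longrightarrow> smooth \<phi>"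
  by (simp add: test_function_def)

lemma test_function_differentiable: "test_function \<phi> \<Longrightarrow> \<phi> differentiable (at x)"
  by (simp add: test_function_smooth smooth_differentiable)

lemma test_function_measurable: "test_function \<phi> \<Longrightarrow> \<phi> \<in> borel_measurable borel"
  by (intro borel_measurable_continuous_onI smooth_continuous test_function_smooth)

lemma test_function_support:
  assumes "test_function \<phi>"
  obtains R where "R \<ge> 0" "\<And>x. \<phi> x \<noteq> 0 \<Longrightarrow> norm x \<le> R"
proof -
  have "bounded (closure {x. \<phi> x \<noteq> 0})"
    using assms by (simp add: test_function_def compact_imp_bounded)
  then obtain R where R: "\<forall>x\<in>closure {x. \<phi> x \<noteq> 0}. norm x \<le> R"
    unfolding bounded_iff by blast
  then have "norm x \<le> max R 0" if "\<phi> x \<noteq> 0" for x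
  proof -
    have "x \<in> closure {x. \<phi> x \<noteq> 0}"
      by (rule subsetD[OF closure_subset]) (simp add: that)
    then show ?thesis using R by fastforce
  qed
  then show ?thesis using that[of "max R 0"] by auto
qed

lemma test_function_bounded:
  assumes "test_function \<phi>"
  obtains B where "B \<ge> 0" "\<And>x. \<bar>\<phi> x\<bar> \<le> B"
proof -
  have "compact (\<phi> ` closure {x. \<phi> x \<noteq> 0})"
    using assms by (intro compact_continuous_image smooth_continuous) (auto simp: test_function_def)
  then obtain B where B: "\<forall>y\<in>\<phi> ` closure {x. \<phi> x \<noteq> 0}. norm y \<le> B"
    using compact_imp_bounded bounded_iff by metis
  have "\<bar>\<phi> x\<bar> \<le> max B 0" for x
  proof (cases "\<phi> x = 0")
    case False
    then have "x \<in> closure {x. \<phi> x \<noteq> 0}" 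
      by (intro subsetD[OF closure_subset]) simp
    then show ?thesis using B by (auto simp: max_def)
  qed auto
  then show ?thesis using that[of "max B 0"] by auto
qed

lemma test_function_partial:
  assumes "test_function \<phi>"
  shows "test_function (partial i \<phi>)"
proof (rule test_functionI)
  show "smooth (partial i \<phi>)"
    using assms by (simp add: test_function_def smooth_partial)
  show "bounded (closure {x. \<phi> x \<noteq> 0})"
    using assms by (simp add: test_function_def compact_imp_bounded)
  fix x assume "partial i \<phi> x \<noteq> 0"
  show "x \<in> closure {x. \<phi> x \<noteq> 0}"
  proof (rule ccontr)
    assume x: "x \<notin> closure {x. \<phi> x \<noteq> 0}"
    let ?U = "- closure {x. \<phi> x \<noteq> 0}"
    have z: "0 = \<phi> y" if "y \<in> ?U" for y
      using that subsetD[OF closure_subset, of y "{x. \<phi> x \<noteq> 0}"] by auto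
    have "(\<phi> has_derivative (\<lambda>h. 0)) (at x)"
    proof (rule has_derivative_transform_within_open[OF has_derivative_const[of 0] _ _ z])
      show "open ?U" by (simp add: open_Compl)
      show "x \<in> ?U" using x by blast
    qed
    from partial_eqI[OF this] show False using \<open>partial i \<phi> x \<noteq> 0\<close> by simp
  qed
qed

lemma test_function_translate:
  assumes "test_function \<phi>"
  shows "test_function (\<lambda>x. \<phi> (x - a))"
proof -
  obtain R where R: "\<And>x. \<phi> x \<noteq> 0 \<Longrightarrow> norm x \<le> R"
    using test_function_support[OF assms] by metis
  have *: "foldr partial ks (\<lambda>x. \<phi> (x - a)) = (\<lambda>x. foldr partial ks \<phi> (x - a)) \<and>
      smooth (foldr partial ks \<phi>)" for ks
  proof (induction ks)
    case Nil
    then show ?case using assms by (simp add: test_function_smooth)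
  next
    case (Cons k ks)
    then show ?case
      by (auto simp: partial_translate smooth_differentiable smooth_partial)
  qed
  have "smooth (\<lambda>x. \<phi> (x - a))"
    unfolding smooth_def differentiable_on_def
  proof (intro allI ballI)
    fix ks x
    show "foldr partial ks (\<lambda>x. \<phi> (x - a)) differentiable (at x)"
      using * by (metis partial_translate(1) smooth_differentiable)
  qed
  then show ?thesis
  proof (rule test_functionI)
    show "bounded (cball a R)" by simp
    fix x assume "\<phi> (x - a) \<noteq> 0"
    then show "x \<in> cball a R" using R by (force simp: dist_norm norm_minus_commute)
  qed
qed

text \<open>These approximants take the place of mollifiers: by dominated convergence a statement
  tested on test functions becomes one about integrals over boxes.\<close>

lemma test_functions_approximate_box:
  fixes a b :: R3
  obtains f :: "nat \<Rightarrow> R3 \<Rightarrow> real" where "\<And>n. test_function (f n)"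
    "\<And>n x. \<bar>f n x\<bar> \<le> indicator (box a b) x" "\<And>x. (\<lambda>n. f n x) \<longlonglongrightarrow> indicator (box a b) x"
proof -
  \<comment> \<open>The factor for \<open>k\<close> is positive exactly when x lies strictly between
    \<open>a\<close> and \<open>b\<close> in that coordinate. So \<open>h\<close> is smooth and
    positive precisely on the open box, and 1 - exp(-n h) climbs to 1 there while it stays 0
    outside.\<close>
  define h where "h x = (\<Prod>k\<in>UNIV. flat 1 (1 * x $ k + - a $ k) * flat 1 (-1 * x $ k + b $ k))"
    for x :: R3
  define f where "f n x = 1 + - 1 * exp (- real n * h x)" for n x
  have "smooth h"
    unfolding h_def by (intro smooth_prod smooth_mult smooth_flat_coord)
  then have sm: "smooth (f n)" for n
    unfolding f_def by (intro smooth_add smooth_mult smooth_exp smooth_const)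
  have fl: "flat 1 t \<ge> 0" "flat 1 t > 0 \<longleftrightarrow> t > 0" for t
    by (auto simp: flat_def)
  have h_pos: "h x > 0" if "x \<in> box a b" for x
    unfolding h_def
  proof (intro prod_pos mult_pos_pos)
    show "0 < flat 1 (1 * x $ k + - a $ k)" "0 < flat 1 (-1 * x $ k + b $ k)" for k
      using that unfolding fl mem_box_cart by simp_all
  qed
  have h_0: "h x = 0" if x: "x \<notin> box a b" for x
  proof -
    obtain k where "a $ k \<ge> x $ k \<or> x $ k \<ge> b $ k"
      using x by (auto simp: mem_box_cart not_less)
    then have "flat 1 (1 * x $ k + - a $ k) * flat 1 (-1 * x $ k + b $ k) = 0"
      by (auto simp: flat_def)
    then show ?thesis unfolding h_def by (intro prod_zero bexI[of _ k]) simp_all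
  qed
  have "h x \<ge> 0" for x
    unfolding h_def by (intro prod_nonneg mult_nonneg_nonneg fl)
  then have bd: "\<bar>f n x\<bar> \<le> indicator (box a b) x" for n x
    using h_0[of x] by (cases "x \<in> box a b") (auto simp: f_def)
  have lim: "(\<lambda>n. f n x) \<longlonglongrightarrow> indicator (box a b) x" for x
  proof (cases "x \<in> box a b")
    case True
    have "exp (- h x) < 1" using h_pos[OF True] by simp
    then have "(\<lambda>n. exp (- h x) ^ n) \<longlonglongrightarrow> 0"
      by (rule LIMSEQ_realpow_zero[OF exp_ge_zero])
    from tendsto_add[OF tendsto_const tendsto_mult[OF tendsto_const this], of 1 "- 1"]
    have "(\<lambda>n. 1 + - 1 * exp (- h x) ^ n) \<longlonglongrightarrow> 1" by simp
    moreover have "f n x = 1 + - 1 * exp (- h x) ^ n" for n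
      by (simp add: f_def exp_of_nat_mult[symmetric])
    ultimately show ?thesis using True by simp
  qed (simp add: f_def h_0)
  have "test_function (f n)" for n
  proof (rule test_functionI[OF sm bounded_box])
    fix x assume "f n x \<noteq> 0"
    then show "x \<in> box a b" using bd[of n x] by (cases "x \<in> box a b") auto
  qed
  then show ?thesis using that bd lim by blast
qed

section \<open>The fundamental lemma of the calculus of variations\<close>

lemma locally_integrable_measurable: "locally_integrable f \<Longrightarrow> f \<in> borel_measurable borel"
  by (simp add: locally_integrable_def)

lemma integrable_mult_bounded_support:
  assumes "locally_integrable f" "\<phi> \<in> borel_measurable borel"
    and "\<And>x. \<bar>\<phi> x\<bar> \<le> B" "\<And>x. \<phi> x \<noteq> 0 \<Longrightarrow> norm x \<le> R"
  shows "integrable lborel (\<lambda>x. f x * \<phi> x)"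
proof -
  have "set_integrable lborel (cball 0 R) f"
    using assms(1) by (simp add: locally_integrable_def)
  then have "integrable lborel (\<lambda>x. B * (indicator (cball 0 R) x * f x))"
    by (simp add: set_integrable_def)
  then show ?thesis
  proof (rule Bochner_Integration.integrable_bound)
    show "(\<lambda>x. f x * \<phi> x) \<in> borel_measurable lborel"
      using borel_measurable_times[OF locally_integrable_measurable[OF assms(1)] assms(2)] by simp
    show "AE x in lborel. norm (f x * \<phi> x) \<le> norm (B * (indicator (cball 0 R) x * f x))"
    proof (intro AE_I2)
      fix x
      have "\<bar>\<phi> x\<bar> \<le> \<bar>B\<bar> * indicator (cball 0 R) x"
        using assms(3,4)[of x] by (cases "\<phi> x = 0") auto
      then show "norm (f x * \<phi> x) \<le> norm (B * (indicator (cball 0 R) x * f x))"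
        using mult_right_mono[of "\<bar>\<phi> x\<bar>" "\<bar>B\<bar> * indicator (cball 0 R) x" "\<bar>f x\<bar>"]
        by (simp add: abs_mult mult_ac)
    qed
  qed
qed

lemma integrable_mult_test_function:
  assumes "locally_integrable f" "test_function \<phi>"
  shows "integrable lborel (\<lambda>x. f x * \<phi> x)"
  by (metis assms integrable_mult_bounded_support test_function_measurable
      test_function_bounded test_function_support)

text \<open>Approximating indicators of boxes by test functions makes every integral of
  \<open>f\<close> over a box vanish, and Lebesgue differentiation recovers \<open>f\<close> from
  these integrals.\<close>

lemma integral_test_functions_zero_imp_AE_zero:
  assumes f: "locally_integrable f"
    and z: "\<And>\<phi>. test_function \<phi> \<Longrightarrow> (LINT x|lborel. f x * \<phi> x) = 0"
  shows "AE x in lborel. f x = 0"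
proof -
  have ci: "set_integrable lborel (cbox a b) f" for a b
    using f by (simp add: locally_integrable_def)
  have bi: "set_integrable lborel (box a b) f" for a b
    by (rule set_integrable_subset[OF ci[of a b]]) (simp_all add: box_subset_cbox)
  have zero: "integral (cbox a b) f = 0" for a b
  proof -
    obtain g :: "nat \<Rightarrow> R3 \<Rightarrow> real" where g: "\<And>n. test_function (g n)"
      "\<And>n x. \<bar>g n x\<bar> \<le> indicator (box a b) x" "\<And>x. (\<lambda>n. g n x) \<longlonglongrightarrow> indicator (box a b) x"
      using test_functions_approximate_box by blast
    have "(\<lambda>n. LINT x|lborel. f x * g n x) \<longlonglongrightarrow> (LINT x|lborel. f x * indicator (box a b) x)"
    proof (rule integral_dominated_convergence[where w="\<lambda>x. \<bar>indicator (box a b) x * f x\<bar>"])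
      show "(\<lambda>x. f x * indicator (box a b) x) \<in> borel_measurable lborel"
        using borel_measurable_times[OF locally_integrable_measurable[OF f]] by simp
      show "(\<lambda>x. f x * g n x) \<in> borel_measurable lborel" for n
        using borel_measurable_times[OF locally_integrable_measurable[OF f]
            test_function_measurable[OF g(1)]] by simp
      show "integrable lborel (\<lambda>x. \<bar>indicator (box a b) x * f x\<bar>)"
        using bi[of a b] by (simp add: set_integrable_def)
      show "AE x in lborel. (\<lambda>n. f x * g n x) \<longlonglongrightarrow> f x * indicator (box a b) x"
        using g(3) by (intro AE_I2 tendsto_intros)
      show "AE x in lborel. norm (f x * g n x) \<le> \<bar>indicator (box a b) x * f x\<bar>" for n
        using mult_right_mono[OF g(2)] by (intro AE_I2) (simp add: abs_mult mult.commute)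
    qed
    then have "(LINT x|lborel. f x * indicator (box a b) x) = 0"
      using z[OF g(1)] by (simp add: LIMSEQ_const_iff)
    then have "integral (box a b) f = 0"
      using set_borel_integral_eq_integral(2)[OF bi[of a b]]
      by (simp add: set_lebesgue_integral_def mult.commute)
    then show ?thesis by (simp add: integral_open_interval)
  qed
  \<comment> \<open>Lebesgue differentiation over cubes with corner \<open>x\<close>. All averages
    vanish by \<open>zero\<close>, so off \<open>N\<close> the value of \<open>f\<close> is smaller
    than any positive error.\<close>
  obtain N where N: "negligible N"
    "\<And>x e. \<lbrakk>x \<notin> N; 0 < e\<rbrakk> \<Longrightarrow> \<exists>d>0. \<forall>h. 0 < h \<and> h < d \<longrightarrow>
       norm (integral (cbox x (x + h *\<^sub>R One)) f /\<^sub>R h ^ DIM(R3) - f x) < e"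
    using integrable_ccontinuous_explicit[of f] set_borel_integral_eq_integral(1)[OF ci] by blast
  have "f x = 0" if x: "x \<notin> N" for x
  proof (rule ccontr)
    assume "f x \<noteq> 0"
    then obtain d :: real where "d > 0" "\<forall>h. 0 < h \<and> h < d \<longrightarrow> norm (- f x) < \<bar>f x\<bar>"
      using N(2)[OF x, of "\<bar>f x\<bar>"] by (auto simp: zero)
    from this(2)[rule_format, of "d/2"] this(1) show False by simp
  qed
  then have "{x. f x \<noteq> 0} \<subseteq> N" by auto
  then have "negligible {x. f x \<noteq> 0}" using N(1) negligible_subset by blast
  then have "{x. f x \<noteq> 0} \<in> null_sets lebesgue"
    by (simp add: negligible_iff_null_sets)
  then have "AE x in lebesgue. f x = 0"
    by (rule AE_I'[where N="{x. f x \<noteq> 0}"]) auto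
  then show ?thesis
    by (simp add: AE_completion_iff)
qed

section \<open>Symmetry of second derivatives\<close>

lemma mixed_difference_mvt:
  assumes f: "smooth f" and t: "t > 0"
  obtains r s where "0 < r" "r < t" "0 < s" "s < t"
    "f (x + t *\<^sub>R axis i 1 + t *\<^sub>R axis j 1) - f (x + t *\<^sub>R axis i 1)
      - f (x + t *\<^sub>R axis j 1) + f x = t * t * partial j (partial i f) (x + r *\<^sub>R axis i 1 + s *\<^sub>R axis j 1)"
proof -
  note d = smooth_differentiable[OF f]
  \<comment> \<open>The mean value theorem is applied to the increment in direction \<open>j\<close>
    as a function of the step in direction \<open>i\<close>, and then once more to the derivative so
    obtained.\<close>
  have "((\<lambda>r. f (x + t *\<^sub>R axis j 1 + r *\<^sub>R axis i 1) - f (x + r *\<^sub>R axis i 1)) has_real_derivative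
    partial i f (x + t *\<^sub>R axis j 1 + r *\<^sub>R axis i 1) - partial i f (x + r *\<^sub>R axis i 1)) (at r)" for r
    by (intro DERIV_diff partial_along_line d)
  from MVT2[OF t this] obtain r where r: "0 < r" "r < t" and
    1: "(f (x + t *\<^sub>R axis j 1 + t *\<^sub>R axis i 1) - f (x + t *\<^sub>R axis i 1)) - (f (x + t *\<^sub>R axis j 1) - f x)
     = t * (partial i f (x + t *\<^sub>R axis j 1 + r *\<^sub>R axis i 1) - partial i f (x + r *\<^sub>R axis i 1))"
    by auto
  have "((\<lambda>s. partial i f (x + r *\<^sub>R axis i 1 + s *\<^sub>R axis j 1)) has_real_derivative
    partial j (partial i f) (x + r *\<^sub>R axis i 1 + s *\<^sub>R axis j 1)) (at s)" for s
    by (intro partial_along_line smooth_differentiable smooth_partial f)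
  from MVT2[OF t this] obtain s where s: "0 < s" "s < t" and
    2: "partial i f (x + r *\<^sub>R axis i 1 + t *\<^sub>R axis j 1) - partial i f (x + r *\<^sub>R axis i 1)
     = t * partial j (partial i f) (x + r *\<^sub>R axis i 1 + s *\<^sub>R axis j 1)"
    by auto
  show ?thesis
    by (rule that[OF r s]) (use 1 2 in \<open>simp add: algebra_simps\<close>)
qed

text \<open>The mixed second difference is symmetric in the two directions, so one number is
  represented by either mixed derivative at a point near \<open>x\<close>. Both are continuous,
  since derivatives of smooth functions are again differentiable.\<close>

lemma partial_commute:
  assumes f: "smooth f"
  shows "partial i (partial j f) = partial j (partial i f)"
proof (rule ext, rule ccontr)
  fix x
  let ?p = "partial i (partial j f)" and ?q = "partial j (partial i f)"
  assume ne: "?p x \<noteq> ?q x"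
  \<comment> \<open>If each mixed derivative moves by less than \<open>e\<close>, the values at
    \<open>x\<close> differ by less than 2 e, which is the assumed gap.\<close>
  define e where "e = \<bar>?p x - ?q x\<bar> / 2"
  have e: "e > 0" using ne by (simp add: e_def)
  have "continuous (at x) ?p" "continuous (at x) ?q"
    by (intro differentiable_imp_continuous_within smooth_differentiable smooth_partial f)+
  then have "\<exists>d>0. \<forall>y. dist y x < d \<longrightarrow> dist (?p y) (?p x) < e"
    "\<exists>d>0. \<forall>y. dist y x < d \<longrightarrow> dist (?q y) (?q x) < e"
    using e unfolding continuous_at_eps_delta by blast+
  then obtain d1 d2 where d: "d1 > 0" "\<And>y. dist y x < d1 \<Longrightarrow> dist (?p y) (?p x) < e"
    "d2 > 0" "\<And>y. dist y x < d2 \<Longrightarrow> dist (?q y) (?q x) < e"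
    by blast
  define t where "t = min d1 d2 / 2"
  have t: "t > 0" "2 * t \<le> d1" "2 * t \<le> d2" using d by (auto simp: t_def)
  have near: "dist (x + r *\<^sub>R axis k 1 + s *\<^sub>R axis l 1) x < 2 * t"
    if "0 < r" "r < t" "0 < s" "s < t" for r s and k l :: 3
  proof -
    have "norm (r *\<^sub>R axis k (1::real) + s *\<^sub>R axis l 1) \<le> r + s"
      using that by (intro order_trans[OF norm_triangle_ineq]) (simp add: norm_axis_1)
    then show ?thesis using that by (simp add: dist_norm add.assoc)
  qed
  obtain r s where 1: "0 < r" "r < t" "0 < s" "s < t"
    "f (x + t *\<^sub>R axis i 1 + t *\<^sub>R axis j 1) - f (x + t *\<^sub>R axis i 1)
      - f (x + t *\<^sub>R axis j 1) + f x = t * t * ?q (x + r *\<^sub>R axis i 1 + s *\<^sub>R axis j 1)"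
    using mixed_difference_mvt[OF f t(1)] by metis
  obtain r' s' where 2: "0 < r'" "r' < t" "0 < s'" "s' < t"
    "f (x + t *\<^sub>R axis j 1 + t *\<^sub>R axis i 1) - f (x + t *\<^sub>R axis j 1)
      - f (x + t *\<^sub>R axis i 1) + f x = t * t * ?p (x + r' *\<^sub>R axis j 1 + s' *\<^sub>R axis i 1)"
    using mixed_difference_mvt[OF f t(1)] by metis
  have "t * t * ?q (x + r *\<^sub>R axis i 1 + s *\<^sub>R axis j 1) =
      t * t * ?p (x + r' *\<^sub>R axis j 1 + s' *\<^sub>R axis i 1)"
    using 1(5) 2(5) by (simp add: algebra_simps)
  then have "?q (x + r *\<^sub>R axis i 1 + s *\<^sub>R axis j 1) = ?p (x + r' *\<^sub>R axis j 1 + s' *\<^sub>R axis i 1)"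
    using t(1) by simp
  moreover have "dist (?q (x + r *\<^sub>R axis i 1 + s *\<^sub>R axis j 1)) (?q x) < e"
    using near[OF 1(1-4), of i j] t by (intro d(4)) simp
  moreover have "dist (?p (x + r' *\<^sub>R axis j 1 + s' *\<^sub>R axis i 1)) (?p x) < e"
    using near[OF 2(1-4), of j i] t by (intro d(2)) simp
  ultimately have "\<bar>?p x - ?q x\<bar> < 2 * e" by (simp add: dist_real_def)
  then show False by (simp add: e_def)
qed

section \<open>Weak derivatives along lines\<close>

lemma nn_integral_lborel_translate:
  fixes f :: "'a::euclidean_space \<Rightarrow> ennreal"
  assumes [measurable]: "f \<in> borel_measurable borel"
  shows "(\<integral>\<^sup>+x. f (x + a) \<partial>lborel) = (\<integral>\<^sup>+x. f x \<partial>lborel)"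
  by (subst (2) lborel_distr_plus[of a, symmetric])
     (simp add: nn_integral_distr add.commute)

lemma integral_lborel_translate:
  fixes f :: "'a::euclidean_space \<Rightarrow> real"
  assumes [measurable]: "f \<in> borel_measurable borel"
  shows "(LINT x|lborel. f (x + a)) = (LINT x|lborel. f x)"
  by (subst (2) lborel_distr_plus[of a, symmetric])
     (simp add: integral_distr add.commute)

lemma integrable_lborel_translate:
  fixes f :: "'a::euclidean_space \<Rightarrow> real"
  assumes "integrable lborel f"
  shows "integrable lborel (\<lambda>x. f (x + a))"
proof -
  have "integrable (distr lborel borel ((+) a)) f"
    using assms by (simp add: lborel_distr_plus)
  then show ?thesis
    by (subst (asm) integrable_distr_eq) (use assms in \<open>auto simp: add.commute\<close>)
qed

lemma locally_integrableI_cball: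
  assumes "f \<in> borel_measurable borel"
    and "\<And>R. integrable lborel (\<lambda>x. indicator (cball 0 R) x * f x)"
  shows "locally_integrable f"
  unfolding locally_integrable_def
proof (intro conjI allI impI assms(1))
  fix K :: "R3 set" assume K: "compact K"
  then obtain R where R: "K \<subseteq> cball 0 R"
    using compact_imp_bounded[OF K] by (force simp: bounded_iff)
  have "set_integrable lborel (cball 0 R) f"
    using assms(2) by (simp add: set_integrable_def)
  then show "set_integrable lborel K f"
    by (rule set_integrable_subset) (use K R in \<open>auto simp: compact_imp_closed\<close>)
qed

lemma locally_integrable_cball:
  "locally_integrable f \<Longrightarrow> integrable lborel (\<lambda>x. indicator (cball 0 R) x * f x)"
  by (simp add: locally_integrable_def set_integrable_def)

text \<open>Supplies the hypothesis of Fubini for integrands shifted along a line. For 0 \<le> s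
  \<le> t the shifted point stays in the enlarged ball \<open>D\<close>, and translation invariance
  bounds the inner integral by the same \<open>C\<close> for every \<open>s\<close>.\<close>

lemma integrable_strip:
  fixes c :: R3 and \<Psi> :: "real \<Rightarrow> R3 \<Rightarrow> real"
  assumes G: "locally_integrable G"
    and \<Psi>[measurable]: "case_prod \<Psi> \<in> borel_measurable (borel \<Otimes>\<^sub>M borel)"
    and B: "\<And>s x. \<bar>\<Psi> s x\<bar> \<le> B"
    and supp: "\<And>s x. \<Psi> s x \<noteq> 0 \<Longrightarrow> 0 \<le> s \<and> s \<le> t \<and> norm x \<le> R"
  shows "integrable (lborel \<Otimes>\<^sub>M lborel) (\<lambda>(s, x). G (x + s *\<^sub>R c) * \<Psi> s x)"
proof -
  note [measurable] = locally_integrable_measurable[OF G]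
  define D where "D = cball (0::R3) (R + t * norm c)"
  have [measurable]: "D \<in> sets borel" by (simp add: D_def)
  have [measurable]: "(\<lambda>p. \<Psi> (fst p) (snd p)) \<in> borel_measurable (borel \<Otimes>\<^sub>M borel)"
    using \<Psi> by (simp add: case_prod_beta')
  define C where "C = (\<integral>\<^sup>+x. ennreal (B * \<bar>indicator D x * G x\<bar>) \<partial>lborel)"
  have "integrable lborel (\<lambda>x. B * \<bar>indicator D x * G x\<bar>)"
    using locally_integrable_cball[OF G] by (simp add: D_def)
  moreover have "0 \<le> B" using B[of 0 0] by simp
  then have norm_eq: "norm (B * \<bar>indicator D x * G x\<bar>) = B * \<bar>indicator D x * G x\<bar>" for x
    by simp
  ultimately have C: "C < \<infinity>"
    unfolding C_def integrable_iff_bounded norm_eq by blast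
  have bound: "ennreal (norm (G (x + s *\<^sub>R c) * \<Psi> s x)) \<le>
      indicator {0..t} s * ennreal (B * \<bar>indicator D (x + s *\<^sub>R c) * G (x + s *\<^sub>R c)\<bar>)" for s x
  proof (cases "\<Psi> s x = 0")
    case False
    then have s: "0 \<le> s" "s \<le> t" "norm x \<le> R" using supp by auto
    have "norm (x + s *\<^sub>R c) \<le> R + t * norm c"
      using s by (intro order_trans[OF norm_triangle_ineq] add_mono) (auto intro: mult_right_mono)
    then have "x + s *\<^sub>R c \<in> D" by (simp add: D_def)
    then show ?thesis
      using s mult_right_mono[OF B, of "\<bar>G (x + s *\<^sub>R c)\<bar>" s x]
      by (simp add: abs_mult mult.commute ennreal_leI)
  qed simp
  have "(\<integral>\<^sup>+p. ennreal (norm (case p of (s, x) \<Rightarrow> G (x + s *\<^sub>R c) * \<Psi> s x)) \<partial>(lborel \<Otimes>\<^sub>M lborel))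
      = (\<integral>\<^sup>+s. \<integral>\<^sup>+x. ennreal (norm (G (x + s *\<^sub>R c) * \<Psi> s x)) \<partial>lborel \<partial>lborel)"
    by (subst lborel.nn_integral_fst[symmetric]) (auto simp: case_prod_beta')
  also have "\<dots> \<le> (\<integral>\<^sup>+s. \<integral>\<^sup>+x. indicator {0..t} s *
      ennreal (B * \<bar>indicator D (x + s *\<^sub>R c) * G (x + s *\<^sub>R c)\<bar>) \<partial>lborel \<partial>lborel)"
    by (intro nn_integral_mono bound)
  also have "\<dots> = (\<integral>\<^sup>+s. indicator {0..t} s * C \<partial>lborel)"
  proof (rule nn_integral_cong)
    fix s :: real
    have "(\<integral>\<^sup>+x. ennreal (B * \<bar>indicator D (x + s *\<^sub>R c) * G (x + s *\<^sub>R c)\<bar>) \<partial>lborel) = C"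
      unfolding C_def by (rule nn_integral_lborel_translate) measurable
    then show "(\<integral>\<^sup>+x. indicator {0..t} s *
      ennreal (B * \<bar>indicator D (x + s *\<^sub>R c) * G (x + s *\<^sub>R c)\<bar>) \<partial>lborel) = indicator {0..t} s * C"
      by (subst nn_integral_cmult) auto
  qed
  also have "\<dots> = C * emeasure lborel {0..t}"
    by (subst nn_integral_multc) (auto simp: mult.commute)
  also have "\<dots> < \<infinity>"
    using C by (auto simp: ennreal_mult_less_top emeasure_lborel_Icc_eq)
  finally show ?thesis
    by (intro integrableI_bounded) (auto simp: case_prod_beta')
qed

text \<open>The shift is backwards because it is the forward shift of \<open>f\<close>, moved onto
  the test function.\<close>

lemma integral_partial_along_line:
  assumes \<phi>: "test_function \<phi>" and t: "0 \<le> t"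
  shows "(LINT s|lborel. partial i \<phi> (x - s *\<^sub>R axis i 1) * indicator {0..t} s)
    = \<phi> x - \<phi> (x - t *\<^sub>R axis i 1)"
proof -
  have d: "((\<lambda>s. - \<phi> (x - s *\<^sub>R axis i 1)) has_real_derivative partial i \<phi> (x - s *\<^sub>R axis i 1)) (at s)" for s
  proof -
    have "((\<lambda>s. \<phi> (x + s *\<^sub>R axis i 1)) has_real_derivative partial i \<phi> (x + (- s) *\<^sub>R axis i 1)) (at (- s))"
      by (rule partial_along_line) (rule test_function_differentiable[OF \<phi>])
    from DERIV_minus[OF DERIV_chain2[OF this DERIV_minus[OF DERIV_ident]]] show ?thesis by simp
  qed
  have c: "isCont (\<lambda>s. partial i \<phi> (x - s *\<^sub>R axis i 1)) s" for s
  proof -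
    have "isCont (partial i \<phi>) y" for y
      by (intro differentiable_imp_continuous_within test_function_differentiable
          test_function_partial \<phi>)
    then show ?thesis
      by (intro isCont_o2[where g="partial i \<phi>" and f="\<lambda>s. x - s *\<^sub>R axis i 1"])
         (auto intro!: continuous_intros)
  qed
  show ?thesis
    using integral_FTC_Icc_real[OF t d c] by simp
qed

text \<open>The fundamental theorem of calculus by duality. The shift of \<open>f\<close> passes to
  the test function, where the classical theorem holds along each line; Fubini and the weak
  derivative, tested with shifted functions, lead back to \<open>g\<close>. The exceptional null set
  may still depend on \<open>t\<close>.\<close>

lemma weak_partial_translate_diff:
  assumes W: "is_weak_partial i f g" and t: "0 \<le> t"
  shows "AE x in lborel. f (x + t *\<^sub>R axis i 1) = f x +
    (LINT s:{0..t}|lborel. g (x + s *\<^sub>R axis i 1))"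
proof -
  have f: "locally_integrable f" and g: "locally_integrable g"
    and wp: "\<And>\<phi>. test_function \<phi> \<Longrightarrow>
        (LINT x|lborel. f x * partial i \<phi> x) = - (LINT x|lborel. g x * \<phi> x)"
    using W by (auto simp: is_weak_partial_def)
  note [measurable] = locally_integrable_measurable[OF f] locally_integrable_measurable[OF g]
  let ?e = "axis i (1::real) :: R3"
  define k where "k x = (LINT s|lborel. g (x + s *\<^sub>R ?e) * indicator {0..t} s)" for x
  define h where "h x = f (x + t *\<^sub>R ?e) - f x - k x" for x
  have [measurable]: "k \<in> borel_measurable borel"
    unfolding k_def by measurable
  have [measurable]: "h \<in> borel_measurable borel"
    unfolding h_def by measurable
  have strip: "integrable (lborel \<Otimes>\<^sub>M lborel) (\<lambda>(s, x). g (x + s *\<^sub>R ?e) * (indicator {0..t} s * \<psi> x))"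
    if [measurable]: "\<psi> \<in> borel_measurable borel" and B: "\<And>x. \<bar>\<psi> x\<bar> \<le> B"
      and R: "\<And>x. \<psi> x \<noteq> 0 \<Longrightarrow> norm x \<le> R" for \<psi> B R
  proof (rule integrable_strip[OF g])
    show "case_prod (\<lambda>s x. indicator {0..t} s * \<psi> x) \<in> borel_measurable (borel \<Otimes>\<^sub>M borel)"
      by measurable
    show "\<bar>indicator {0..t} s * \<psi> x\<bar> \<le> B" for s x
      using B[of x] abs_ge_zero[of "\<psi> x"] by (cases "s \<in> {0..t}") auto
    show "0 \<le> s \<and> s \<le> t \<and> norm x \<le> R" if "indicator {0..t} s * \<psi> x \<noteq> 0" for s x
      using that R[of x] by (auto simp: indicator_def split: if_splits)
  qed
  have k_eq: "(LINT s|lborel. g (x + s *\<^sub>R ?e) * (indicator {0..t} s * c)) = k x * c" for x c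
    unfolding k_def by (simp flip: mult.assoc)
  have "locally_integrable h"
  proof (rule locally_integrableI_cball)
    fix R :: real
    define \<psi> where "\<psi> = (indicator (cball 0 R) :: R3 \<Rightarrow> real)"
    have [measurable]: "\<psi> \<in> borel_measurable borel" unfolding \<psi>_def by (intro borel_measurable_indicator) simp
    have "integrable lborel (\<lambda>x. LINT s|lborel. g (x + s *\<^sub>R ?e) * (indicator {0..t} s * \<psi> x))"
      by (rule lborel_pair.integrable_snd[OF strip[of \<psi> 1 R]])
         (measurable, auto simp: \<psi>_def indicator_def split: if_splits)
    then have "integrable lborel (\<lambda>x. \<psi> x * k x)"
      unfolding k_eq by (simp add: mult.commute)
    moreover have "integrable lborel (\<lambda>x. \<psi> x * f x)"
      unfolding \<psi>_def by (rule locally_integrable_cball[OF f])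
    moreover have "integrable lborel (\<lambda>x. \<psi> x * f (x + t *\<^sub>R ?e))"
    proof -
      have "integrable lborel (\<lambda>x. f x * \<psi> (x - t *\<^sub>R ?e))"
      proof (rule integrable_mult_bounded_support[OF f])
        show "(\<lambda>x. \<psi> (x - t *\<^sub>R ?e)) \<in> borel_measurable borel"
          by measurable
        show "\<bar>\<psi> (x - t *\<^sub>R ?e)\<bar> \<le> 1" for x by (simp add: \<psi>_def indicator_def)
        show "norm x \<le> R + t" if "\<psi> (x - t *\<^sub>R ?e) \<noteq> 0" for x
        proof -
          have "norm (x - t *\<^sub>R ?e) \<le> R"
            using that by (auto simp: \<psi>_def indicator_def split: if_splits)
          then show ?thesis
            using norm_triangle_ineq[of "x - t *\<^sub>R ?e" "t *\<^sub>R ?e"] t by (simp add: norm_axis_1)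
        qed
      qed
      from integrable_lborel_translate[OF this, of "t *\<^sub>R ?e"] show ?thesis
        by (simp add: mult.commute)
    qed
    ultimately have "integrable lborel (\<lambda>x. \<psi> x * f (x + t *\<^sub>R ?e) - \<psi> x * f x - \<psi> x * k x)"
      by auto
    then show "integrable lborel (\<lambda>x. indicator (cball 0 R) x * h x)"
      by (simp add: \<psi>_def h_def algebra_simps)
  qed measurable
  moreover have "(LINT x|lborel. h x * \<phi> x) = 0" if \<phi>: "test_function \<phi>" for \<phi>
  proof -
    note [measurable] = test_function_measurable[OF \<phi>]
      test_function_measurable[OF test_function_partial[OF \<phi>, of i]]
    obtain B R where B: "\<And>x. \<bar>\<phi> x\<bar> \<le> B" and R: "\<And>x. \<phi> x \<noteq> 0 \<Longrightarrow> norm x \<le> R"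
      using test_function_bounded[OF \<phi>] test_function_support[OF \<phi>] by metis
    obtain B' R' where B': "\<And>x. \<bar>partial i \<phi> x\<bar> \<le> B'"
      and R': "\<And>x. partial i \<phi> x \<noteq> 0 \<Longrightarrow> norm x \<le> R'"
      using test_function_bounded[OF test_function_partial[OF \<phi>]]
        test_function_support[OF test_function_partial[OF \<phi>]] by metis
    have \<phi>s: "test_function (\<lambda>x. \<phi> (x - s *\<^sub>R ?e))" for s
      by (rule test_function_translate[OF \<phi>])
    have ps: "partial i (\<lambda>x. \<phi> (x - s *\<^sub>R ?e)) = (\<lambda>x. partial i \<phi> (x - s *\<^sub>R ?e))" for s
      by (intro ext partial_translate test_function_differentiable[OF \<phi>])
    have shift: "(LINT x|lborel. F (x + s *\<^sub>R ?e) * \<phi> x) = (LINT x|lborel. F x * \<phi> (x - s *\<^sub>R ?e))"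
      if [measurable]: "F \<in> borel_measurable borel" for F s
      using integral_lborel_translate[of "\<lambda>x. F x * \<phi> (x - s *\<^sub>R ?e)" "s *\<^sub>R ?e"] by simp
    have i1: "integrable lborel (\<lambda>x. f (x + t *\<^sub>R ?e) * \<phi> x)"
      using integrable_lborel_translate[OF integrable_mult_test_function[OF f \<phi>s[of t]], of "t *\<^sub>R ?e"]
      by simp
    have i2: "integrable lborel (\<lambda>x. f x * \<phi> x)"
      by (rule integrable_mult_test_function[OF f \<phi>])
    have s2: "integrable (lborel \<Otimes>\<^sub>M lborel) (\<lambda>(s, x). g (x + s *\<^sub>R ?e) * (indicator {0..t} s * \<phi> x))"
      by (rule strip[OF _ B R]) measurable
    have i3: "integrable lborel (\<lambda>x. k x * \<phi> x)"
      using lborel_pair.integrable_snd[OF s2] unfolding k_eq .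
    \<comment> \<open>Here \<open>f\<close> is not shifted, so the direction is 0 and the shift sits
      in the kernel; this enlarges the radius of its support by \<open>t\<close>.\<close>
    have "integrable (lborel \<Otimes>\<^sub>M lborel) (\<lambda>(s, x). f (x + s *\<^sub>R 0) * (indicator {0..t} s * partial i \<phi> (x - s *\<^sub>R ?e)))"
    proof (rule integrable_strip[OF f])
      show "case_prod (\<lambda>s x. indicator {0..t} s * partial i \<phi> (x - s *\<^sub>R ?e)) \<in> borel_measurable (borel \<Otimes>\<^sub>M borel)"
        by measurable
      show "\<bar>indicator {0..t} s * partial i \<phi> (x - s *\<^sub>R ?e)\<bar> \<le> B'" for s x
        using B'[of "x - s *\<^sub>R ?e"] abs_ge_zero[of "partial i \<phi> (x - s *\<^sub>R ?e)"]
        by (cases "s \<in> {0..t}") auto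
      show "0 \<le> s \<and> s \<le> t \<and> norm x \<le> R' + t"
        if "indicator {0..t} s * partial i \<phi> (x - s *\<^sub>R ?e) \<noteq> 0" for s x
      proof -
        have "0 \<le> s" "s \<le> t" "norm (x - s *\<^sub>R ?e) \<le> R'"
          using that R'[of "x - s *\<^sub>R ?e"] by (auto simp: indicator_def split: if_splits)
        then show ?thesis
          using norm_triangle_ineq[of "x - s *\<^sub>R ?e" "s *\<^sub>R ?e"] by (simp add: norm_axis_1)
      qed
    qed
    then have s1: "integrable (lborel \<Otimes>\<^sub>M lborel) (\<lambda>(s, x). f x * (indicator {0..t} s * partial i \<phi> (x - s *\<^sub>R ?e)))"
      by simp
    have "(LINT x|lborel. f (x + t *\<^sub>R ?e) * \<phi> x) - (LINT x|lborel. f x * \<phi> x)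
        = (LINT x|lborel. f x * \<phi> (x - t *\<^sub>R ?e)) - (LINT x|lborel. f x * \<phi> x)"
      by (simp add: shift)
    also have "\<dots> = (LINT x|lborel. f x * \<phi> (x - t *\<^sub>R ?e) - f x * \<phi> x)"
      by (rule Bochner_Integration.integral_diff[symmetric])
         (intro integrable_mult_test_function f \<phi> \<phi>s)+
    also have "\<dots> = (LINT x|lborel. - (LINT s|lborel. f x * (indicator {0..t} s * partial i \<phi> (x - s *\<^sub>R ?e))))"
    proof (rule Bochner_Integration.integral_cong[OF refl])
      fix x
      have "(LINT s|lborel. f x * (indicator {0..t} s * partial i \<phi> (x - s *\<^sub>R ?e))) =
          f x * (\<phi> x - \<phi> (x - t *\<^sub>R ?e))"
        unfolding integral_partial_along_line[OF \<phi> t, symmetric] by (simp add: mult.commute)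
      then show "f x * \<phi> (x - t *\<^sub>R ?e) - f x * \<phi> x =
          - (LINT s|lborel. f x * (indicator {0..t} s * partial i \<phi> (x - s *\<^sub>R ?e)))"
        by (simp only:) (simp add: algebra_simps)
    qed
    also have "\<dots> = - (LINT s|lborel. LINT x|lborel. f x * (indicator {0..t} s * partial i \<phi> (x - s *\<^sub>R ?e)))"
      by (subst Bochner_Integration.integral_minus, subst lborel_pair.Fubini_integral[OF s1])
         (rule refl)
    \<comment> \<open>For each \<open>s\<close> the weak derivative is tested with the shifted
      \<phi>, and translation invariance moves the shift over to \<open>g\<close>.\<close>
    also have "\<dots> = (LINT s|lborel. LINT x|lborel. g (x + s *\<^sub>R ?e) * (indicator {0..t} s * \<phi> x))"
    proof (subst Bochner_Integration.integral_minus[symmetric], rule Bochner_Integration.integral_cong[OF refl])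
      fix s :: real
      have "(LINT x|lborel. f x * (indicator {0..t} s * partial i \<phi> (x - s *\<^sub>R ?e))) =
         indicator {0..t} s * (LINT x|lborel. f x * partial i \<phi> (x - s *\<^sub>R ?e))"
        by (subst integral_mult_right_zero[symmetric]) (simp only: mult_ac)
      also have "\<dots> = - (indicator {0..t} s * (LINT x|lborel. g (x + s *\<^sub>R ?e) * \<phi> x))"
        using wp[OF \<phi>s[of s]] by (simp add: ps shift)
      also have "\<dots> = - (LINT x|lborel. g (x + s *\<^sub>R ?e) * (indicator {0..t} s * \<phi> x))"
        by (subst integral_mult_right_zero[symmetric]) (simp only: mult_ac)
      finally show "- (LINT x|lborel. f x * (indicator {0..t} s * partial i \<phi> (x - s *\<^sub>R ?e))) =
        (LINT x|lborel. g (x + s *\<^sub>R ?e) * (indicator {0..t} s * \<phi> x))" by simp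
    qed
    also have "\<dots> = (LINT x|lborel. LINT s|lborel. g (x + s *\<^sub>R ?e) * (indicator {0..t} s * \<phi> x))"
      by (rule lborel_pair.Fubini_integral[OF s2, symmetric])
    also have "\<dots> = (LINT x|lborel. k x * \<phi> x)"
      by (simp add: k_eq)
    finally have "(LINT x|lborel. f (x + t *\<^sub>R ?e) * \<phi> x) - (LINT x|lborel. f x * \<phi> x)
        - (LINT x|lborel. k x * \<phi> x) = 0" by simp
    then have "(LINT x|lborel. f (x + t *\<^sub>R ?e) * \<phi> x - f x * \<phi> x - k x * \<phi> x) = 0"
      using i1 i2 i3 by simp
    then show ?thesis
      by (simp add: h_def left_diff_distrib)
  qed
  ultimately have "AE x in lborel. h x = 0"
    by (rule integral_test_functions_zero_imp_AE_zero)
  then show ?thesis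
    by eventually_elim (simp add: h_def k_def set_lebesgue_integral_def mult.commute)
qed

text \<open>Space is not sliced into lines: the base point ranges over almost all of R3 instead of a
  transversal plane, and only forward increments are compared. Asking for almost every
  \<open>t\<close> makes the notion insensitive to changes of \<open>f\<close> on a null
  set.\<close>

definition abs_cont_lines :: "3 \<Rightarrow> (R3 \<Rightarrow> real) \<Rightarrow> (R3 \<Rightarrow> real) \<Rightarrow> bool" where
  "abs_cont_lines i f g \<longleftrightarrow> f \<in> borel_measurable borel \<and> g \<in> borel_measurable borel \<and>
   (AE x in lborel. (\<forall>T. set_integrable lborel {0..T} (\<lambda>s. g (x + s *\<^sub>R axis i 1))) \<and>
      (AE t in lborel. 0 \<le> t \<longrightarrow>
        f (x + t *\<^sub>R axis i 1) = f x + (LINT s:{0..t}|lborel. g (x + s *\<^sub>R axis i 1))))"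

text \<open>Fubini gives integrability along lines once \<open>x\<close> is confined to a ball. The
  balls of radius \<open>n\<close>, paired with the intervals [0, n], are countably many, and a
  large \<open>n\<close> covers any given \<open>x\<close> and \<open>T\<close>.\<close>

lemma AE_set_integrable_along_line:
  assumes g: "locally_integrable g"
  shows "AE x in lborel. \<forall>T. set_integrable lborel {0..T} (\<lambda>s. g (x + s *\<^sub>R axis i 1))"
proof -
  note [measurable] = locally_integrable_measurable[OF g]
  have "AE x in lborel. \<forall>n::nat. set_integrable lborel {0..real n} (\<lambda>s. indicator (cball 0 (real n)) x * g (x + s *\<^sub>R axis i 1))"
    unfolding AE_all_countable
  proof
    fix n :: nat
    have "integrable (lborel \<Otimes>\<^sub>M lborel) (\<lambda>(s, x). g (x + s *\<^sub>R axis i 1) *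
        (indicator {0..real n} s * indicator (cball 0 (real n)) x))"
      by (rule integrable_strip[OF g, of _ 1 "real n" "real n"])
         (measurable, auto simp: indicator_def split: if_splits)
    from lborel_pair.integrable_product_swap[OF this]
    have "integrable (lborel \<Otimes>\<^sub>M lborel) (\<lambda>(x, s). g (x + s *\<^sub>R axis i 1) *
        (indicator {0..real n} s * indicator (cball 0 (real n)) x))"
      by (simp only: prod.case)
    from lborel_pair.AE_integrable_fst'[OF this]
    show "AE x in lborel. set_integrable lborel {0..real n} (\<lambda>s. indicator (cball 0 (real n)) x * g (x + s *\<^sub>R axis i 1))"
      unfolding set_integrable_def by (simp add: mult_ac)
  qed
  then show ?thesis
  proof eventually_elim
    case (elim x)
    show ?case
    proof
      fix T :: real
      obtain n :: nat where n: "real n \<ge> max T (norm x)" using real_arch_simple by blast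
      have "set_integrable lborel {0..real n} (\<lambda>s. g (x + s *\<^sub>R axis i 1))"
        using elim[rule_format, of n] n by simp
      then show "set_integrable lborel {0..T} (\<lambda>s. g (x + s *\<^sub>R axis i 1))"
        by (rule set_integrable_subset) (use n in auto)
    qed
  qed
qed

lemma measurable_line_integral:
  fixes g :: "R3 \<Rightarrow> real"
  assumes [measurable]: "g \<in> borel_measurable borel"
  shows "(\<lambda>p. LINT s:{0..fst p}|lborel. g (snd p + s *\<^sub>R axis i 1)) \<in> borel_measurable (lborel \<Otimes>\<^sub>M lborel)"
proof -
  \<comment> \<open>The moving endpoint is put into the integrand, which is then jointly measurable
    in \<open>p\<close> and \<open>s\<close>.\<close>
  have "(\<lambda>p. LINT s|lborel. (if 0 \<le> s \<and> s \<le> fst p then g (snd p + s *\<^sub>R axis i 1) else 0))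
      \<in> borel_measurable (lborel \<Otimes>\<^sub>M lborel)"
    by measurable
  moreover have "(LINT s|lborel. (if 0 \<le> s \<and> s \<le> fst p then g (snd p + s *\<^sub>R axis i 1) else 0)) =
      (LINT s:{0..fst p}|lborel. g (snd p + s *\<^sub>R axis i 1))" for p
    unfolding set_lebesgue_integral_def
    by (rule Bochner_Integration.integral_cong) (auto simp: indicator_def)
  ultimately show ?thesis by simp
qed

text \<open>Duality yields a null set of base points for each increment, whereas calculus on a line
  needs a null set of increments for each base point. Joint measurability permits the exchange, in
  both directions.\<close>

lemma line_identity_AE_commute:
  fixes f g :: "R3 \<Rightarrow> real"
  assumes [measurable]: "f \<in> borel_measurable borel" "g \<in> borel_measurable borel"
  shows "(AE t in lborel. AE x in lborel. 0 \<le> t \<longrightarrow>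
        f (x + t *\<^sub>R axis i 1) = f x + (LINT s:{0..t}|lborel. g (x + s *\<^sub>R axis i 1))) \<longleftrightarrow>
    (AE x in lborel. AE t in lborel. 0 \<le> t \<longrightarrow>
        f (x + t *\<^sub>R axis i 1) = f x + (LINT s:{0..t}|lborel. g (x + s *\<^sub>R axis i 1)))"
proof (rule lborel_pair.AE_commute)
  define k where "k p = (LINT s:{0..fst p}|lborel. g (snd p + s *\<^sub>R axis i 1))" for p :: "real \<times> R3"
  have [measurable]: "k \<in> borel_measurable (lborel \<Otimes>\<^sub>M lborel)"
    unfolding k_def by (rule measurable_line_integral) fact
  have "{p \<in> space (lborel \<Otimes>\<^sub>M lborel). 0 \<le> fst p \<longrightarrow>
      f (snd p + fst p *\<^sub>R axis i 1) = f (snd p) + k p} \<in> sets (lborel \<Otimes>\<^sub>M lborel)"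
    by measurable
  then show "{p \<in> space (lborel \<Otimes>\<^sub>M lborel). 0 \<le> fst p \<longrightarrow>
      f (snd p + fst p *\<^sub>R axis i 1) = f (snd p) +
        (LINT s:{0..fst p}|lborel. g (snd p + s *\<^sub>R axis i 1))} \<in> sets (lborel \<Otimes>\<^sub>M lborel)"
    unfolding k_def .
qed

lemma weak_partial_imp_abs_cont_lines:
  assumes W: "is_weak_partial i f g"
  shows "abs_cont_lines i f g"
proof -
  have f: "f \<in> borel_measurable borel" and g: "g \<in> borel_measurable borel" "locally_integrable g"
    using W by (auto simp: is_weak_partial_def locally_integrable_def)
  have "AE x in lborel. 0 \<le> t \<longrightarrow>
        f (x + t *\<^sub>R axis i 1) = f x + (LINT s:{0..t}|lborel. g (x + s *\<^sub>R axis i 1))" for t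
    by (cases "0 \<le> t") (simp_all add: weak_partial_translate_diff[OF W])
  then have "AE t in lborel. AE x in lborel. 0 \<le> t \<longrightarrow>
        f (x + t *\<^sub>R axis i 1) = f x + (LINT s:{0..t}|lborel. g (x + s *\<^sub>R axis i 1))"
    by (rule AE_I2)
  then show ?thesis
    unfolding abs_cont_lines_def line_identity_AE_commute[OF f g(1)]
    using f g AE_set_integrable_along_line[OF g(2)] by simp
qed

section \<open>Products and integration by parts\<close>

lemma integrable_pair_mult:
  fixes G H :: "real \<Rightarrow> real"
  assumes "integrable lborel G" "integrable lborel H"
  shows "integrable (lborel \<Otimes>\<^sub>M lborel) (\<lambda>(s, r). G s * H r)"
proof (rule lborel_pair.Fubini_integrable)
  have [measurable]: "G \<in> borel_measurable borel" "H \<in> borel_measurable borel"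
    using assms by auto
  show "(\<lambda>(s, r). G s * H r) \<in> borel_measurable (lborel \<Otimes>\<^sub>M lborel)"
    by measurable
  show "integrable lborel (\<lambda>s. LINT r|lborel. norm (case (s, r) of (s, r) \<Rightarrow> G s * H r))"
    using assms by (simp add: abs_mult)
  show "AE s in lborel. integrable lborel (\<lambda>r. case (s, r) of (s, r) \<Rightarrow> G s * H r)"
    using assms by simp
qed

text \<open>Fubini on the square with side [0, T], cut along the diagonal: each triangle is one of
  the two iterated integrals.\<close>

lemma integral_by_parts_indefinite:
  fixes g h :: "real \<Rightarrow> real"
  assumes g: "set_integrable lborel {0..T} g" and h: "set_integrable lborel {0..T} h"
  shows "set_integrable lborel {0..T} (\<lambda>s. g s * (LINT r:{0..s}|lborel. h r))"
    and "(LINT s:{0..T}|lborel. g s * (LINT r:{0..s}|lborel. h r)) +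
         (LINT r:{0..T}|lborel. h r * (LINT s:{0..r}|lborel. g s)) =
         (LINT s:{0..T}|lborel. g s) * (LINT r:{0..T}|lborel. h r)"
proof -
  define G where "G s = indicator {0..T} s * g s" for s
  define H where "H s = indicator {0..T} s * h s" for s
  have G: "integrable lborel G" and H: "integrable lborel H"
    using g h by (simp_all add: G_def[abs_def] H_def[abs_def] set_integrable_def)
  have [measurable]: "G \<in> borel_measurable borel" "H \<in> borel_measurable borel"
    using G H by auto
  have GH: "integrable (lborel \<Otimes>\<^sub>M lborel) (\<lambda>(s, r). G s * H r)"
    by (rule integrable_pair_mult[OF G H])
  have below: "integrable (lborel \<Otimes>\<^sub>M lborel) (\<lambda>(s, r). G s * H r * (if r \<le> s then 1 else 0))"
    by (rule Bochner_Integration.integrable_bound[OF GH]) (auto simp: case_prod_beta')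
  have above: "integrable (lborel \<Otimes>\<^sub>M lborel) (\<lambda>(s, r). G s * H r * (if s < r then 1 else 0))"
    by (rule Bochner_Integration.integrable_bound[OF GH]) (auto simp: case_prod_beta')
  have inner1: "(LINT r|lborel. G s * H r * (if r \<le> s then 1 else 0)) =
      indicator {0..T} s * (g s * (LINT r:{0..s}|lborel. h r))" for s
  proof -
    have "(LINT r|lborel. G s * H r * (if r \<le> s then 1 else 0)) =
        (LINT r|lborel. (indicator {0..T} s * g s) * (indicator {0..s} r * h r))"
      by (rule Bochner_Integration.integral_cong) (auto simp: G_def H_def indicator_def)
    then show ?thesis by (simp add: set_lebesgue_integral_def mult.assoc)
  qed
  have inner2: "(LINT s|lborel. G s * H r * (if s < r then 1 else 0)) =
      indicator {0..T} r * (h r * (LINT s:{0..r}|lborel. g s))" for r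
  proof -
    \<comment> \<open>The cut leaves one triangle with a strict inequality; the missing diagonal
      point is a null set on each line.\<close>
    have "(LINT s|lborel. G s * H r * (if s < r then 1 else 0)) = (LINT s|lborel. G s * H r * (if s \<le> r then 1 else 0))"
      using AE_lborel_singleton[of r] by (intro integral_cong_AE) auto
    also have "\<dots> = (LINT s|lborel. (indicator {0..T} r * h r) * (indicator {0..r} s * g s))"
      by (rule Bochner_Integration.integral_cong) (auto simp: G_def H_def indicator_def)
    finally show ?thesis by (simp add: set_lebesgue_integral_def mult.assoc)
  qed
  show "set_integrable lborel {0..T} (\<lambda>s. g s * (LINT r:{0..s}|lborel. h r))"
    using lborel_pair.integrable_fst'[OF below] unfolding set_integrable_def prod.case inner1
    by simp
  have "(LINT s|lborel. LINT r|lborel. G s * H r) =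
      (LINT s|lborel. (LINT r|lborel. G s * H r * (if r \<le> s then 1 else 0)) + (LINT r|lborel. G s * H r * (if s < r then 1 else 0)))"
  proof (rule Bochner_Integration.integral_cong[OF refl])
    fix s
    have GsH: "integrable lborel (\<lambda>r. G s * H r)" using H by simp
    have "integrable lborel (\<lambda>r. G s * H r * (if r \<le> s then 1 else 0))"
      "integrable lborel (\<lambda>r. G s * H r * (if s < r then 1 else 0))"
      by (rule Bochner_Integration.integrable_bound[OF GsH]; auto)+
    then have "(LINT r|lborel. G s * H r * (if r \<le> s then 1 else 0)) + (LINT r|lborel. G s * H r * (if s < r then 1 else 0))
      = (LINT r|lborel. G s * H r * (if r \<le> s then 1 else 0) + G s * H r * (if s < r then 1 else 0))"
      by (rule Bochner_Integration.integral_add[symmetric])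
    also have "\<dots> = (LINT r|lborel. G s * H r)"
      by (rule Bochner_Integration.integral_cong) auto
    finally show "(LINT r|lborel. G s * H r) = (LINT r|lborel. G s * H r * (if r \<le> s then 1 else 0)) +
       (LINT r|lborel. G s * H r * (if s < r then 1 else 0))" ..
  qed
  also have "\<dots> = (LINT s|lborel. LINT r|lborel. G s * H r * (if r \<le> s then 1 else 0)) +
      (LINT s|lborel. LINT r|lborel. G s * H r * (if s < r then 1 else 0))"
    using lborel_pair.integrable_fst'[OF below] lborel_pair.integrable_fst'[OF above]
    unfolding prod.case by (rule Bochner_Integration.integral_add)
  also have "(LINT s|lborel. LINT r|lborel. G s * H r * (if s < r then 1 else 0)) =
      (LINT r|lborel. LINT s|lborel. G s * H r * (if s < r then 1 else 0))"
    by (rule lborel_pair.Fubini_integral[OF above, symmetric])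
  finally have "(LINT s|lborel. LINT r|lborel. G s * H r) =
     (LINT s|lborel. indicator {0..T} s * (g s * (LINT r:{0..s}|lborel. h r))) +
     (LINT r|lborel. indicator {0..T} r * (h r * (LINT s:{0..r}|lborel. g s)))"
    unfolding inner1 inner2 .
  moreover have "(LINT s|lborel. LINT r|lborel. G s * H r) = integral\<^sup>L lborel G * integral\<^sup>L lborel H"
    by simp
  ultimately show "(LINT s:{0..T}|lborel. g s * (LINT r:{0..s}|lborel. h r)) +
         (LINT r:{0..T}|lborel. h r * (LINT s:{0..r}|lborel. g s)) =
         (LINT s:{0..T}|lborel. g s) * (LINT r:{0..T}|lborel. h r)"
    by (simp add: set_lebesgue_integral_def G_def[abs_def] H_def[abs_def])
qed

lemma product_rule_indefinite:
  fixes f k g h :: "real \<Rightarrow> real"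
  assumes [measurable]: "f \<in> borel_measurable borel" "k \<in> borel_measurable borel"
      "g \<in> borel_measurable borel" "h \<in> borel_measurable borel"
    and g: "\<And>T. set_integrable lborel {0..T} g" and h: "\<And>T. set_integrable lborel {0..T} h"
    and f: "AE t in lborel. 0 \<le> t \<longrightarrow> f t = a + (LINT s:{0..t}|lborel. g s)"
    and k: "AE t in lborel. 0 \<le> t \<longrightarrow> k t = b + (LINT s:{0..t}|lborel. h s)"
  shows "set_integrable lborel {0..T} (\<lambda>s. f s * h s + g s * k s)"
    and "AE t in lborel. 0 \<le> t \<longrightarrow>
      f t * k t = a * b + (LINT s:{0..t}|lborel. f s * h s + g s * k s)"
proof -
  \<comment> \<open>The integrand with \<open>f\<close> and \<open>k\<close> replaced by their
    indefinite integrals. The two integrands agree only almost everywhere, which is enough inside an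
    integral.\<close>
  define I where "I s = a * h s + h s * (LINT r:{0..s}|lborel. g r) + (b * g s + g s * (LINT r:{0..s}|lborel. h r))" for s
  have hI: "set_integrable lborel {0..T} (\<lambda>s. h s * (LINT r:{0..s}|lborel. g r))"
    and gI: "set_integrable lborel {0..T} (\<lambda>s. g s * (LINT r:{0..s}|lborel. h r))" for T
    by (rule integral_by_parts_indefinite(1)[OF h g]) (rule integral_by_parts_indefinite(1)[OF g h])
  have I: "set_integrable lborel {0..T} I" for T
    unfolding I_def by (intro set_integral_add set_integrable_mult_right g h hI gI)
  have ae: "AE s in lborel. indicator {0..T} s *\<^sub>R I s = indicator {0..T} s *\<^sub>R (f s * h s + g s * k s)" for T
    using f k by eventually_elim (auto simp: I_def algebra_simps indicator_def)
  show "set_integrable lborel {0..T} (\<lambda>s. f s * h s + g s * k s)" for T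
    unfolding set_integrable_def
    by (rule integrable_cong_AE_imp[OF I[of T, unfolded set_integrable_def] _ ae]) measurable
  have eq: "(LINT s:{0..T}|lborel. f s * h s + g s * k s) = (LINT s:{0..T}|lborel. I s)" for T
    unfolding set_lebesgue_integral_def
    using ae[of T] I[of T, unfolded set_integrable_def] by (intro integral_cong_AE) auto
  have val: "(LINT s:{0..T}|lborel. I s) = a * (LINT s:{0..T}|lborel. h s) + b * (LINT s:{0..T}|lborel. g s)
      + (LINT s:{0..T}|lborel. g s) * (LINT s:{0..T}|lborel. h s)" for T
  proof -
    have ah: "set_integrable lborel {0..T} (\<lambda>s. a * h s)" and bg: "set_integrable lborel {0..T} (\<lambda>s. b * g s)"
      by (intro set_integrable_mult_right g h)+
    have "(LINT s:{0..T}|lborel. I s) = ((LINT s:{0..T}|lborel. a * h s) + (LINT s:{0..T}|lborel. h s * (LINT r:{0..s}|lborel. g r)))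
      + ((LINT s:{0..T}|lborel. b * g s) + (LINT s:{0..T}|lborel. g s * (LINT r:{0..s}|lborel. h r)))"
      unfolding I_def set_integral_add(2)[OF ah hI, symmetric] set_integral_add(2)[OF bg gI, symmetric]
      by (intro set_integral_add(2) set_integral_add(1) ah bg hI gI)
    then show ?thesis
      using integral_by_parts_indefinite(2)[OF g[of T] h[of T]] by simp
  qed
  show "AE t in lborel. 0 \<le> t \<longrightarrow>
      f t * k t = a * b + (LINT s:{0..t}|lborel. f s * h s + g s * k s)"
    using f k unfolding eq val by eventually_elim (auto simp: algebra_simps)
qed

text \<open>The rule holds on each good line by itself, where integrability on bounded intervals
  suffices. Since no integrability over space is asked of the product, the rule can be iterated
  before any estimate is known.\<close>

lemma abs_cont_lines_mult:
  assumes "abs_cont_lines i f g" "abs_cont_lines i k h"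
  shows "abs_cont_lines i (\<lambda>x. f x * k x) (\<lambda>x. f x * h x + g x * k x)"
proof -
  have [measurable]: "f \<in> borel_measurable borel" "k \<in> borel_measurable borel"
      "g \<in> borel_measurable borel" "h \<in> borel_measurable borel"
    and f: "AE x in lborel. (\<forall>T. set_integrable lborel {0..T} (\<lambda>s. g (x + s *\<^sub>R axis i 1))) \<and>
      (AE t in lborel. 0 \<le> t \<longrightarrow>
        f (x + t *\<^sub>R axis i 1) = f x + (LINT s:{0..t}|lborel. g (x + s *\<^sub>R axis i 1)))"
    and k: "AE x in lborel. (\<forall>T. set_integrable lborel {0..T} (\<lambda>s. h (x + s *\<^sub>R axis i 1))) \<and>
      (AE t in lborel. 0 \<le> t \<longrightarrow>
        k (x + t *\<^sub>R axis i 1) = k x + (LINT s:{0..t}|lborel. h (x + s *\<^sub>R axis i 1)))"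
    using assms by (auto simp: abs_cont_lines_def)
  show ?thesis
    unfolding abs_cont_lines_def
  proof (intro conjI)
    show "AE x in lborel. (\<forall>T. set_integrable lborel {0..T} (\<lambda>s. f (x + s *\<^sub>R axis i 1) * h (x + s *\<^sub>R axis i 1) +
           g (x + s *\<^sub>R axis i 1) * k (x + s *\<^sub>R axis i 1))) \<and>
      (AE t in lborel. 0 \<le> t \<longrightarrow> f (x + t *\<^sub>R axis i 1) * k (x + t *\<^sub>R axis i 1) = f x * k x +
         (LINT s:{0..t}|lborel. f (x + s *\<^sub>R axis i 1) * h (x + s *\<^sub>R axis i 1) +
           g (x + s *\<^sub>R axis i 1) * k (x + s *\<^sub>R axis i 1)))"
      using f k
    proof eventually_elim
      case (elim x)
      show ?case
        by (intro conjI allI product_rule_indefinite[where a="f x" and b="k x"])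
           (use elim in \<open>auto intro!: borel_measurable_scaleR\<close>)
    qed
  qed measurable
qed

section \<open>Vanishing of integrated derivatives\<close>

lemma AE_lborel_positive_witness:
  assumes "AE t in lborel. P (t::real)"
  obtains t where "t > 0" "P t"
proof (rule ccontr)
  assume "\<not> thesis"
  then have "\<not> P t" if "t > 0" for t using that \<open>\<And>t. 0 < t \<Longrightarrow> P t \<Longrightarrow> thesis\<close> by blast
  with assms have "AE t in lborel. t \<notin> {0<..1::real}"
    by (auto elim: eventually_mono)
  then have "emeasure lborel {0<..1::real} = 0"
    by (subst (asm) AE_iff_measurable[where N="{0<..1::real}"]) auto
  then show False by simp
qed

text \<open>A single increment t > 0 suffices. Integrated over space, the difference of
  \<open>F\<close> and its translate gives 0 by translation invariance, while the line integral of
  \<open>G\<close> gives \<open>t\<close> times its integral.\<close>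

lemma integral_derivative_eq_0:
  assumes ac: "abs_cont_lines i F G" and F: "integrable lborel F" and G: "integrable lborel G"
  shows "integral\<^sup>L lborel G = 0"
proof -
  let ?e = "axis i (1::real) :: R3"
  have [measurable]: "F \<in> borel_measurable borel" "G \<in> borel_measurable borel"
    using ac by (auto simp: abs_cont_lines_def)
  have "AE x in lborel. AE t in lborel. 0 \<le> t \<longrightarrow>
        F (x + t *\<^sub>R ?e) = F x + (LINT s:{0..t}|lborel. G (x + s *\<^sub>R ?e))"
    using ac by (auto simp: abs_cont_lines_def elim: eventually_mono)
  then have "AE t in lborel. AE x in lborel. 0 \<le> t \<longrightarrow>
        F (x + t *\<^sub>R ?e) = F x + (LINT s:{0..t}|lborel. G (x + s *\<^sub>R ?e))"
    by (subst line_identity_AE_commute) auto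
  then obtain t where t: "t > 0" and eq: "AE x in lborel. 0 \<le> t \<longrightarrow>
        F (x + t *\<^sub>R ?e) = F x + (LINT s:{0..t}|lborel. G (x + s *\<^sub>R ?e))"
    by (rule AE_lborel_positive_witness)
  have GG: "integrable (lborel \<Otimes>\<^sub>M lborel) (\<lambda>(s, x). indicator {0..t} s * G (x + s *\<^sub>R ?e))"
  proof (rule lborel_pair.Fubini_integrable)
    show "(\<lambda>(s, x). indicator {0..t} s * G (x + s *\<^sub>R ?e)) \<in> borel_measurable (lborel \<Otimes>\<^sub>M lborel)"
      by measurable
    have "(LINT x|lborel. norm (indicator {0..t} s * G (x + s *\<^sub>R ?e))) = indicator {0..t} s * (LINT x|lborel. \<bar>G x\<bar>)" for s
      using integral_lborel_translate[of "\<lambda>x. \<bar>G x\<bar>" "s *\<^sub>R ?e"] by (simp add: abs_mult)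
    then show "integrable lborel (\<lambda>s. LINT x|lborel. norm (case (s, x) of (s, x) \<Rightarrow> indicator {0..t} s * G (x + s *\<^sub>R ?e)))"
      using t by simp
    show "AE s in lborel. integrable lborel (\<lambda>x. case (s, x) of (s, x) \<Rightarrow> indicator {0..t} s * G (x + s *\<^sub>R ?e))"
      using integrable_lborel_translate[OF G] by simp
  qed
  have "0 = (LINT x|lborel. F (x + t *\<^sub>R ?e) - F x)"
    using integrable_lborel_translate[OF F, of "t *\<^sub>R ?e"] F integral_lborel_translate[of F "t *\<^sub>R ?e"] by simp
  also have "\<dots> = (LINT x|lborel. LINT s|lborel. indicator {0..t} s * G (x + s *\<^sub>R ?e))"
  proof (rule integral_cong_AE)
    show "(\<lambda>x. F (x + t *\<^sub>R ?e) - F x) \<in> borel_measurable lborel" by measurable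
    show "(\<lambda>x. LINT s|lborel. indicator {0..t} s * G (x + s *\<^sub>R ?e)) \<in> borel_measurable lborel" by measurable
    show "AE x in lborel. F (x + t *\<^sub>R ?e) - F x = (LINT s|lborel. indicator {0..t} s * G (x + s *\<^sub>R ?e))"
      using eq by eventually_elim (use t in \<open>simp add: set_lebesgue_integral_def\<close>)
  qed
  also have "\<dots> = (LINT s|lborel. LINT x|lborel. indicator {0..t} s * G (x + s *\<^sub>R ?e))"
    by (rule lborel_pair.Fubini_integral[OF GG])
  also have "\<dots> = t * integral\<^sup>L lborel G"
    using t integral_lborel_translate[of G] by simp
  finally show ?thesis using t by simp
qed

section \<open>Ladyzhenskaya's inequality\<close>

text \<open>The line integral is constant in direction \<open>i\<close>, so integrating it over all
  of space would diverge unless it vanishes. Over a slab of width one in that direction it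
  integrates exactly to the integral of \<open>h\<close>, and countably many slabs cover
  space.\<close>

lemma AE_nn_integral_line_finite:
  fixes h :: "R3 \<Rightarrow> ennreal"
  assumes [measurable]: "h \<in> borel_measurable borel" and fin: "(\<integral>\<^sup>+x. h x \<partial>lborel) < \<infinity>"
  shows "AE x in lborel. (\<integral>\<^sup>+s. h (x + s *\<^sub>R axis i 1) \<partial>lborel) < \<infinity>"
proof -
  let ?e = "axis i (1::real) :: R3"
  define J where "J x = (\<integral>\<^sup>+s. h (x + s *\<^sub>R ?e) \<partial>lborel)" for x
  have [measurable]: "J \<in> borel_measurable borel"
    unfolding J_def by measurable
  have slab: "(\<integral>\<^sup>+x. indicator {m..m + 1} (x $ i) * J x \<partial>lborel) = (\<integral>\<^sup>+x. h x \<partial>lborel)" for m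
  proof -
    have [measurable]: "(\<lambda>x::R3. x $ i) \<in> borel_measurable borel"
      by (intro borel_measurable_continuous_onI continuous_intros)
    \<comment> \<open>The coordinate of \<open>x\<close> is written as that of the shifted point
      minus \<open>s\<close>. Then the integrand depends on \<open>x\<close> through the shifted
      point only, and translation invariance applies.\<close>
    have "(\<integral>\<^sup>+x. indicator {m..m + 1} (x $ i) * J x \<partial>lborel) =
        (\<integral>\<^sup>+x. \<integral>\<^sup>+s. indicator {m..m + 1} ((x + s *\<^sub>R ?e) $ i - s) * h (x + s *\<^sub>R ?e) \<partial>lborel \<partial>lborel)"
      unfolding J_def by (subst nn_integral_cmult[symmetric]) (simp_all add: axis_def)
    also have "\<dots> = (\<integral>\<^sup>+s. \<integral>\<^sup>+x. indicator {m..m + 1} ((x + s *\<^sub>R ?e) $ i - s) * h (x + s *\<^sub>R ?e) \<partial>lborel \<partial>lborel)"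
      by (rule lborel_pair.Fubini') measurable
    also have "\<dots> = (\<integral>\<^sup>+s. \<integral>\<^sup>+x. indicator {m..m + 1} (x $ i - s) * h x \<partial>lborel \<partial>lborel)"
    proof (rule nn_integral_cong)
      fix s :: real
      show "(\<integral>\<^sup>+x. indicator {m..m + 1} ((x + s *\<^sub>R ?e) $ i - s) * h (x + s *\<^sub>R ?e) \<partial>lborel)
          = (\<integral>\<^sup>+x. indicator {m..m + 1} (x $ i - s) * h x \<partial>lborel)"
        by (rule nn_integral_lborel_translate[where f="\<lambda>x. indicator {m..m + 1} (x $ i - s) * h x"]) measurable
    qed
    also have "\<dots> = (\<integral>\<^sup>+x. \<integral>\<^sup>+s. indicator {m..m + 1} (x $ i - s) * h x \<partial>lborel \<partial>lborel)"
      by (rule lborel_pair.Fubini') measurable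
    also have "\<dots> = (\<integral>\<^sup>+x. h x \<partial>lborel)"
    proof (rule nn_integral_cong)
      fix x :: R3
      have "(\<integral>\<^sup>+s. indicator {m..m + 1} (x $ i - s) * h x \<partial>lborel) =
          (\<integral>\<^sup>+s. h x * indicator {x $ i - m - 1..x $ i - m} s \<partial>lborel)"
        by (rule nn_integral_cong) (auto simp: indicator_def)
      also have "\<dots> = h x" by (subst nn_integral_cmult_indicator) simp_all
      finally show "(\<integral>\<^sup>+s. indicator {m..m + 1} (x $ i - s) * h x \<partial>lborel) = h x" .
    qed
    finally show ?thesis .
  qed
  have [measurable]: "(\<lambda>x::R3. x $ i) \<in> borel_measurable borel"
    by (intro borel_measurable_continuous_onI continuous_intros)
  have "AE x in lborel. indicator {of_int m..of_int m + 1} (x $ i) * J x \<noteq> \<infinity>" for m :: int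
    using slab[of "of_int m"] fin by (intro nn_integral_PInf_AE) auto
  then have "AE x in lborel. \<forall>m::int. indicator {of_int m..of_int m + 1} (x $ i) * J x \<noteq> \<infinity>"
    by (simp add: AE_all_countable)
  then show ?thesis
  proof eventually_elim
    case (elim x)
    have "x $ i \<in> {of_int \<lfloor>x $ i\<rfloor>..of_int \<lfloor>x $ i\<rfloor> + 1}"
      by (simp add: less_imp_le)
    then show ?case
      using elim[rule_format, of "\<lfloor>x $ i\<rfloor>"] by (simp add: J_def less_top)
  qed
qed

lemma emeasure_lborel_atLeast: "emeasure lborel {a::real..} = \<infinity>"
proof (rule ccontr)
  assume "emeasure lborel {a..} \<noteq> \<infinity>"
  then obtain r where r: "emeasure lborel {a..} = ennreal r" "0 \<le> r"
    by (cases "emeasure lborel {a..}") auto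
  have "emeasure lborel {a..a + (r + 1)} \<le> emeasure lborel {a..}"
    by (rule emeasure_mono) auto
  then show False using r by simp
qed

text \<open>By the product rule f^2 drops from its value at \<open>x\<close> by at most the line
  integral of 2|f g|. Were this integral below f^2 at \<open>x\<close>, then f^2 would exceed a
  positive constant almost everywhere on a half-line and have infinite integral there. Taking the
  whole line on the right makes the bound independent of the coordinate along it.\<close>

lemma square_le_line_integral:
  assumes ac: "abs_cont_lines i f g" and fin: "(\<integral>\<^sup>+x. ennreal ((f x)\<^sup>2) \<partial>lborel) < \<infinity>"
  shows "AE x in lborel. ennreal ((f x)\<^sup>2) \<le>
    (\<integral>\<^sup>+s. ennreal (2 * \<bar>f (x + s *\<^sub>R axis i 1) * g (x + s *\<^sub>R axis i 1)\<bar>) \<partial>lborel)"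
proof -
  have [measurable]: "f \<in> borel_measurable borel" "g \<in> borel_measurable borel"
    using ac by (auto simp: abs_cont_lines_def)
  have 1: "AE x in lborel. (\<integral>\<^sup>+s. ennreal ((f (x + s *\<^sub>R axis i 1))\<^sup>2) \<partial>lborel) < \<infinity>"
    by (rule AE_nn_integral_line_finite[OF _ fin]) measurable
  have 2: "AE x in lborel. (\<forall>T. set_integrable lborel {0..T} (\<lambda>s. f (x + s *\<^sub>R axis i 1) * g (x + s *\<^sub>R axis i 1) + g (x + s *\<^sub>R axis i 1) * f (x + s *\<^sub>R axis i 1))) \<and>
      (AE t in lborel. 0 \<le> t \<longrightarrow>
        f (x + t *\<^sub>R axis i 1) * f (x + t *\<^sub>R axis i 1) = f x * f x + (LINT s:{0..t}|lborel. f (x + s *\<^sub>R axis i 1) * g (x + s *\<^sub>R axis i 1) + g (x + s *\<^sub>R axis i 1) * f (x + s *\<^sub>R axis i 1)))"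
    using abs_cont_lines_mult[OF ac ac] by (simp add: abs_cont_lines_def)
  from 1 2 show ?thesis
  proof eventually_elim
    case (elim x)
    define p where "p s = f (x + s *\<^sub>R axis i 1)" for s
    define q where "q s = g (x + s *\<^sub>R axis i 1)" for s
    have [measurable]: "p \<in> borel_measurable borel" "q \<in> borel_measurable borel"
      unfolding p_def q_def by measurable
    define N where "N = (\<integral>\<^sup>+s. ennreal (2 * \<bar>p s * q s\<bar>) \<partial>lborel)"
    have pq: "set_integrable lborel {0..T} (\<lambda>s. p s * q s + q s * p s)" for T
      using elim(2) by (auto simp: p_def q_def)
    have ae: "AE t in lborel. 0 \<le> t \<longrightarrow> p t * p t = f x * f x + (LINT s:{0..t}|lborel. p s * q s + q s * p s)"
      using elim(2) by (auto simp: p_def q_def)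
    have bound: "ennreal \<bar>LINT s:{0..t}|lborel. p s * q s + q s * p s\<bar> \<le> N" for t
    proof -
      have "ennreal \<bar>LINT s:{0..t}|lborel. p s * q s + q s * p s\<bar> \<le>
          (\<integral>\<^sup>+s. ennreal (norm (indicator {0..t} s *\<^sub>R (p s * q s + q s * p s))) \<partial>lborel)"
        using integral_norm_bound_ennreal[OF pq[of t, unfolded set_integrable_def]]
        unfolding set_lebesgue_integral_def real_norm_def .
      also have "\<dots> \<le> N"
        unfolding N_def by (intro nn_integral_mono ennreal_leI) (auto simp: indicator_def abs_mult)
      finally show ?thesis .
    qed
    have "ennreal ((f x)\<^sup>2) \<le> N"
    proof (rule ccontr)
      assume "\<not> ennreal ((f x)\<^sup>2) \<le> N"
      then have less: "N < ennreal ((f x)\<^sup>2)" by simp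
      then obtain n where n: "N = ennreal n" "0 \<le> n" by (cases N) auto
      with less have d: "n < (f x)\<^sup>2" by (simp add: ennreal_less_iff)
      have "AE t in lborel. ennreal ((f x)\<^sup>2 - n) * indicator {0::real..} t \<le> ennreal ((p t)\<^sup>2)"
        using ae
      proof eventually_elim
        case (elim t)
        have "\<bar>LINT s:{0..t}|lborel. p s * q s + q s * p s\<bar> \<le> n"
          using bound[of t] n by simp
        then show ?case
          using elim by (auto simp: indicator_def power2_eq_square intro!: ennreal_leI)
      qed
      then have "(\<integral>\<^sup>+t. ennreal ((f x)\<^sup>2 - n) * indicator {0::real..} t \<partial>lborel) \<le> (\<integral>\<^sup>+t. ennreal ((p t)\<^sup>2) \<partial>lborel)"
        by (rule nn_integral_mono_AE)
      moreover have "(\<integral>\<^sup>+t. ennreal ((f x)\<^sup>2 - n) * indicator {0::real..} t \<partial>lborel) = \<infinity>"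
        using d by (subst nn_integral_cmult_indicator) (simp_all add: emeasure_lborel_atLeast ennreal_mult_eq_top_iff)
      ultimately show False using elim(1) by (simp add: p_def)
    qed
    then show ?case by (simp add: N_def p_def q_def)
  qed
qed

section \<open>Iterated integrals in three coordinates\<close>

abbreviation point3 :: "real \<Rightarrow> real \<Rightarrow> real \<Rightarrow> R3" where
  "point3 c b a \<equiv> c *\<^sub>R axis 3 1 + b *\<^sub>R axis 2 1 + a *\<^sub>R axis 1 1"

lemma sigma_finite_lborel_pair:
  "sigma_finite_measure (lborel \<Otimes>\<^sub>M lborel :: (real \<times> real) measure)"
  by (simp add: lborel_prod sigma_finite_lborel)

text \<open>The third coordinate is outermost because the estimate below fixes a horizontal plane
  and integrates the other two inside it. Lebesgue measure is recognised by its values on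
  boxes.\<close>

lemma lborel_point3:
  "(lborel :: R3 measure) = distr (lborel \<Otimes>\<^sub>M (lborel \<Otimes>\<^sub>M lborel)) borel (\<lambda>(c, b, a). point3 c b a)"
proof (rule lborel_eqI)
  let ?P = "\<lambda>(c, b, a). point3 c b a"
  have meas: "?P \<in> (lborel \<Otimes>\<^sub>M (lborel \<Otimes>\<^sub>M lborel)) \<rightarrow>\<^sub>M borel"
    by measurable
  fix l u :: R3 assume lu: "\<And>b. b \<in> Basis \<Longrightarrow> l \<bullet> b \<le> u \<bullet> b"
  have le: "l $ i \<le> u $ i" for i
    using lu[of "axis i 1"] by (simp add: axis_in_Basis_iff inner_axis)
  have pre: "?P -` box l u \<inter> space (lborel \<Otimes>\<^sub>M (lborel \<Otimes>\<^sub>M lborel)) =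
      {l $ 3<..<u $ 3} \<times> ({l $ 2<..<u $ 2} \<times> {l $ 1<..<u $ 1})"
    by (auto simp: space_pair_measure mem_box_cart forall_3 axis_def)
  interpret M2: sigma_finite_measure "lborel \<Otimes>\<^sub>M lborel :: (real \<times> real) measure"
    by (simp add: lborel_prod sigma_finite_lborel)
  have Basis: "(Basis :: R3 set) = range (\<lambda>i::3. axis i (1::real))"
    by (auto simp: Basis_vec_def)
  have inj: "inj (\<lambda>i::3. axis i (1::real))"
    by (auto simp: inj_on_def axis_eq_axis)
  have "(\<Prod>b\<in>Basis. (u - l) \<bullet> b) = (\<Prod>i\<in>UNIV. (u - l) \<bullet> axis i 1)"
    by (simp only: Basis prod.reindex[OF inj] o_def)
  also have "\<dots> = (u $ 1 - l $ 1) * (u $ 2 - l $ 2) * (u $ 3 - l $ 3)"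
    unfolding UNIV_3 by (simp add: inner_axis mult.assoc)
  finally have prodB: "(\<Prod>b\<in>Basis. (u - l) \<bullet> b) = (u $ 1 - l $ 1) * (u $ 2 - l $ 2) * (u $ 3 - l $ 3)" .
  have "emeasure (lborel \<Otimes>\<^sub>M (lborel \<Otimes>\<^sub>M lborel)) ({l $ 3<..<u $ 3} \<times> ({l $ 2<..<u $ 2} \<times> {l $ 1<..<u $ 1})) =
      ennreal (u $ 3 - l $ 3) * (ennreal (u $ 2 - l $ 2) * ennreal (u $ 1 - l $ 1))"
    using le[of 1] le[of 2] le[of 3]
    by (simp add: sigma_finite_measure.emeasure_pair_measure_Times[OF sigma_finite_lborel_pair] lborel.emeasure_pair_measure_Times)
  also have "\<dots> = ennreal (\<Prod>b\<in>Basis. (u - l) \<bullet> b)"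
    unfolding prodB using le[of 1] le[of 2] le[of 3] by (simp add: ennreal_mult mult_ac)
  finally show "emeasure (distr (lborel \<Otimes>\<^sub>M (lborel \<Otimes>\<^sub>M lborel)) borel ?P) (box l u) =
      ennreal (\<Prod>b\<in>Basis. (u - l) \<bullet> b)"
    by (subst emeasure_distr[OF meas]) (simp_all add: pre)
qed simp

lemma ennreal_mult_le_squares: "x * y \<le> x\<^sup>2 + (y::ennreal)\<^sup>2"
proof (cases "x \<le> y")
  case True
  then have "x * y \<le> y * y" by (intro mult_right_mono) auto
  then show ?thesis by (simp add: power2_eq_square add_increasing)
next
  case False
  then have "x * y \<le> x * x" by (intro mult_left_mono) auto
  then show ?thesis by (simp add: power2_eq_square add_increasing2)
qed

text \<open>Ladyzhenskaya's argument. Along the first two coordinate directions the line integrals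
  bound \<open>f\<^sup>2\<close> twice, and their product factorizes over each horizontal plane; the third direction
  bounds the integral of \<open>f\<^sup>2\<close> over almost every such plane.\<close>

lemma Ladyzhenskaya_finite:
  assumes ac: "\<And>i. abs_cont_lines i f (g i)"
    and f: "(\<integral>\<^sup>+x. ennreal ((f x)\<^sup>2) \<partial>lborel) < \<infinity>"
    and g: "\<And>i. (\<integral>\<^sup>+x. ennreal ((g i x)\<^sup>2) \<partial>lborel) < \<infinity>"
  shows "(\<integral>\<^sup>+x. ennreal ((f x)^4) \<partial>lborel) < \<infinity>"
proof -
  have [measurable]: "f \<in> borel_measurable borel" "\<And>i. g i \<in> borel_measurable borel"
    using ac by (auto simp: abs_cont_lines_def)
  define F where "F x = ennreal \<bar>f x\<bar>" for x
  define G where "G i x = ennreal \<bar>g i x\<bar>" for i x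
  define K where "K i x = 2 * (F x * G i x)" for i x
  define N where "N i x = (\<integral>\<^sup>+s. K i (x + s *\<^sub>R axis i 1) \<partial>lborel)" for i x
  have [measurable]: "F \<in> borel_measurable borel" "\<And>i. G i \<in> borel_measurable borel"
    unfolding F_def G_def by measurable
  have [measurable]: "\<And>i. K i \<in> borel_measurable borel"
    unfolding K_def by measurable
  have [measurable]: "\<And>i. N i \<in> borel_measurable borel"
    unfolding N_def by measurable
  have F2: "F x ^ 2 = ennreal ((f x)\<^sup>2)" for x
    by (simp add: F_def ennreal_power)
  have G2: "G i x ^ 2 = ennreal ((g i x)\<^sup>2)" for i x
    by (simp add: G_def ennreal_power)
  have K: "K i x = ennreal (2 * \<bar>f x * g i x\<bar>)" for i x
    by (simp add: K_def F_def G_def ennreal_mult abs_mult)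
  have bd: "AE x in lborel. F x ^ 2 \<le> N i x" for i
    using square_le_line_integral[OF ac f] by (simp add: F2 N_def K)
  let ?M = "lborel \<Otimes>\<^sub>M lborel :: (real \<times> real) measure"
  let ?P = "\<lambda>c p. point3 c (fst p) (snd p)"
  interpret M: pair_sigma_finite "lborel :: real measure" ?M
    by unfold_locales
  have Pmeas: "(\<lambda>(c, b, a). point3 c b a) \<in> (lborel \<Otimes>\<^sub>M ?M) \<rightarrow>\<^sub>M borel"
    by measurable
  have int3: "(\<integral>\<^sup>+x. h x \<partial>lborel) = (\<integral>\<^sup>+c. \<integral>\<^sup>+p. h (?P c p) \<partial>?M \<partial>lborel)"
    if [measurable]: "h \<in> borel_measurable borel" for h :: "R3 \<Rightarrow> ennreal"
    by (subst lborel_point3, subst nn_integral_distr[OF Pmeas])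
       (simp_all add: sigma_finite_measure.nn_integral_fst[OF sigma_finite_lborel_pair, symmetric] case_prod_beta')
  have ae3: "AE c in lborel. AE p in ?M. Q (?P c p)" if "AE x in lborel. Q x" for Q
  proof -
    have "AE x in distr (lborel \<Otimes>\<^sub>M ?M) borel (\<lambda>(c, b, a). point3 c b a). Q x"
      by (subst lborel_point3[symmetric]) (rule that)
    from M.AE_pair[OF AE_distrD[OF Pmeas this]] show ?thesis by (simp add: case_prod_beta')
  qed
  \<comment> \<open>Shifting the integration variable removes the coordinate of the base point, so
    \<open>N 1\<close> is constant in \<open>a\<close>; likewise for the other two
    directions.\<close>
  have N1: "N 1 (point3 c b a) = (\<integral>\<^sup>+a. K 1 (point3 c b a) \<partial>lborel)" for c b a
  proof -
    have "N 1 (point3 c b a) = (\<integral>\<^sup>+s. K 1 (point3 c b (s + a)) \<partial>lborel)"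
      unfolding N_def by (rule nn_integral_cong) (simp add: algebra_simps)
    also have "\<dots> = (\<integral>\<^sup>+a. K 1 (point3 c b a) \<partial>lborel)"
      by (rule nn_integral_lborel_translate) measurable
    finally show ?thesis .
  qed
  have N2: "N 2 (point3 c b a) = (\<integral>\<^sup>+b. K 2 (point3 c b a) \<partial>lborel)" for c b a
  proof -
    have "N 2 (point3 c b a) = (\<integral>\<^sup>+s. K 2 (point3 c (s + b) a) \<partial>lborel)"
      unfolding N_def by (rule nn_integral_cong) (simp add: algebra_simps)
    also have "\<dots> = (\<integral>\<^sup>+b. K 2 (point3 c b a) \<partial>lborel)"
      by (rule nn_integral_lborel_translate) measurable
    finally show ?thesis .
  qed
  have N3: "N 3 (point3 c b a) = (\<integral>\<^sup>+c. K 3 (point3 c b a) \<partial>lborel)" for c b a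
  proof -
    have "N 3 (point3 c b a) = (\<integral>\<^sup>+s. K 3 (point3 (s + c) b a) \<partial>lborel)"
      unfolding N_def by (rule nn_integral_cong) (simp add: algebra_simps)
    also have "\<dots> = (\<integral>\<^sup>+c. K 3 (point3 c b a) \<partial>lborel)"
      by (rule nn_integral_lborel_translate) measurable
    finally show ?thesis .
  qed
  define A where "A c = (\<integral>\<^sup>+p. F (?P c p) ^ 2 \<partial>?M)" for c
  define B where "B i c = (\<integral>\<^sup>+p. G i (?P c p) ^ 2 \<partial>?M)" for i c
  define Q where "Q i c = (\<integral>\<^sup>+p. K i (?P c p) \<partial>?M)" for i c
  define C where "C = (\<integral>\<^sup>+x. K 3 x \<partial>lborel)"
  have [measurable]: "\<And>i. B i \<in> borel_measurable borel"
    unfolding B_def by measurable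
  have "C \<le> (\<integral>\<^sup>+x. ennreal ((f x)\<^sup>2) + ennreal ((g 3 x)\<^sup>2) \<partial>lborel)"
    unfolding C_def K
  proof (rule nn_integral_mono)
    fix x
    show "ennreal (2 * \<bar>f x * g 3 x\<bar>) \<le> ennreal ((f x)\<^sup>2) + ennreal ((g 3 x)\<^sup>2)"
      using sum_squares_bound[of "\<bar>f x\<bar>" "\<bar>g 3 x\<bar>"]
      by (simp add: ennreal_plus[symmetric] abs_mult ennreal_leI del: ennreal_plus)
  qed
  also have "\<dots> < \<infinity>" using f g by (subst nn_integral_add) auto
  finally have C: "C < \<infinity>" .
  \<comment> \<open>\<open>N 3\<close> is constant in \<open>c\<close>, so its integral over a
    horizontal plane is the integral of \<open>K 3\<close> over space, a bound uniform in
    \<open>c\<close>.\<close>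
  have AC: "AE c in lborel. A c \<le> C"
    using ae3[OF bd[of 3]]
  proof eventually_elim
    case (elim c)
    have "A c \<le> (\<integral>\<^sup>+p. N 3 (?P c p) \<partial>?M)"
      unfolding A_def using elim by (rule nn_integral_mono_AE)
    also have "\<dots> = (\<integral>\<^sup>+p. \<integral>\<^sup>+c. K 3 (?P c p) \<partial>lborel \<partial>?M)"
      by (simp add: N3)
    also have "\<dots> = (\<integral>\<^sup>+c. \<integral>\<^sup>+p. K 3 (?P c p) \<partial>?M \<partial>lborel)"
      by (rule M.Fubini') measurable
    also have "\<dots> = C"
      unfolding C_def by (rule int3[symmetric]) measurable
    finally show ?case .
  qed
  have Q2: "(Q i c)\<^sup>2 \<le> 4 * (A c * B i c)" for i c
  proof -
    have "Q i c = 2 * (\<integral>\<^sup>+p. F (?P c p) * G i (?P c p) \<partial>?M)"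
      unfolding Q_def K_def by (rule nn_integral_cmult) measurable
    moreover have "(\<integral>\<^sup>+p. F (?P c p) * G i (?P c p) \<partial>?M)\<^sup>2 \<le> A c * B i c"
      unfolding A_def B_def by (rule Cauchy_Schwarz_nn_integral) measurable
    ultimately show ?thesis
      by (auto simp: power_mult_distrib intro: mult_left_mono)
  qed
  have "(\<integral>\<^sup>+x. ennreal ((f x)^4) \<partial>lborel) = (\<integral>\<^sup>+x. F x ^ 2 * F x ^ 2 \<partial>lborel)"
    by (intro nn_integral_cong) (simp add: F_def ennreal_power flip: ennreal_mult power_add)
  also have "\<dots> \<le> (\<integral>\<^sup>+x. N 1 x * N 2 x \<partial>lborel)"
  proof (rule nn_integral_mono_AE)
    show "AE x in lborel. F x ^ 2 * F x ^ 2 \<le> N 1 x * N 2 x"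
      using bd[of 1] bd[of 2] by eventually_elim (rule mult_mono, auto)
  qed
  also have "\<dots> = (\<integral>\<^sup>+c. \<integral>\<^sup>+p. N 1 (?P c p) * N 2 (?P c p) \<partial>?M \<partial>lborel)"
    by (rule int3) measurable
  also have "\<dots> = (\<integral>\<^sup>+c. Q 1 c * Q 2 c \<partial>lborel)"
  proof (rule nn_integral_cong)
    fix c :: real
    have "(\<integral>\<^sup>+p. N 1 (?P c p) * N 2 (?P c p) \<partial>?M) =
        (\<integral>\<^sup>+b. \<integral>\<^sup>+a. N 1 (point3 c b a) * N 2 (point3 c b a) \<partial>lborel \<partial>lborel)"
      by (subst lborel.nn_integral_fst[symmetric]) simp_all
    \<comment> \<open>At fixed \<open>c\<close> the first factor depends on \<open>b\<close> alone
      and the second on \<open>a\<close> alone, so the double integral splits into a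
      product.\<close>
    also have "\<dots> = (\<integral>\<^sup>+b. \<integral>\<^sup>+a. (\<integral>\<^sup>+a. K 1 (point3 c b a) \<partial>lborel) * (\<integral>\<^sup>+b. K 2 (point3 c b a) \<partial>lborel) \<partial>lborel \<partial>lborel)"
      by (simp only: N1 N2)
    also have "\<dots> = (\<integral>\<^sup>+b. (\<integral>\<^sup>+a. K 1 (point3 c b a) \<partial>lborel) * (\<integral>\<^sup>+a. \<integral>\<^sup>+b. K 2 (point3 c b a) \<partial>lborel \<partial>lborel) \<partial>lborel)"
      by (intro nn_integral_cong nn_integral_cmult) measurable
    also have "\<dots> = (\<integral>\<^sup>+b. \<integral>\<^sup>+a. K 1 (point3 c b a) \<partial>lborel \<partial>lborel) * (\<integral>\<^sup>+a. \<integral>\<^sup>+b. K 2 (point3 c b a) \<partial>lborel \<partial>lborel)"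
      by (rule nn_integral_multc) measurable
    also have "(\<integral>\<^sup>+a. \<integral>\<^sup>+b. K 2 (point3 c b a) \<partial>lborel \<partial>lborel) = (\<integral>\<^sup>+b. \<integral>\<^sup>+a. K 2 (point3 c b a) \<partial>lborel \<partial>lborel)"
      by (rule lborel_pair.Fubini') measurable
    also have "(\<integral>\<^sup>+b. \<integral>\<^sup>+a. K i (point3 c b a) \<partial>lborel \<partial>lborel) = Q i c" for i
      unfolding Q_def by (subst lborel.nn_integral_fst[symmetric]) simp_all
    finally show "(\<integral>\<^sup>+p. N 1 (?P c p) * N 2 (?P c p) \<partial>?M) = Q 1 c * Q 2 c"
      by (simp add: Q_def lborel.nn_integral_fst[symmetric])
  qed
  \<comment> \<open>Cauchy-Schwarz bounds the square of \<open>Q i\<close> by 4 A B, with the 4 from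
    the factor 2 in \<open>K\<close>. Once \<open>A\<close> is bounded by \<open>C\<close>, only the
    integrable \<open>B i\<close> depend on \<open>c\<close>.\<close>
  also have "\<dots> \<le> (\<integral>\<^sup>+c. 4 * C * (B 1 c + B 2 c) \<partial>lborel)"
  proof (rule nn_integral_mono_AE)
    show "AE c in lborel. Q 1 c * Q 2 c \<le> 4 * C * (B 1 c + B 2 c)"
      using AC
    proof eventually_elim
      case (elim c)
      have "Q 1 c * Q 2 c \<le> (Q 1 c)\<^sup>2 + (Q 2 c)\<^sup>2" by (rule ennreal_mult_le_squares)
      also have "\<dots> \<le> 4 * (A c * B 1 c) + 4 * (A c * B 2 c)" by (intro add_mono Q2)
      also have "\<dots> \<le> 4 * (C * B 1 c) + 4 * (C * B 2 c)"
        using elim by (intro add_mono mult_left_mono mult_right_mono) auto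
      also have "\<dots> = 4 * C * (B 1 c + B 2 c)" by (simp add: distrib_left mult.assoc)
      finally show ?case .
    qed
  qed
  also have "\<dots> = 4 * C * ((\<integral>\<^sup>+c. B 1 c \<partial>lborel) + (\<integral>\<^sup>+c. B 2 c \<partial>lborel))"
    by (simp add: nn_integral_cmult nn_integral_add)
  also have "\<dots> < \<infinity>"
  proof -
    have "(\<integral>\<^sup>+c. B i c \<partial>lborel) = (\<integral>\<^sup>+x. ennreal ((g i x)\<^sup>2) \<partial>lborel)" for i
      unfolding B_def by (subst int3[symmetric]) (simp_all add: G2)
    then show ?thesis using C g by (simp add: ennreal_mult_less_top)
  qed
  finally show ?thesis .
qed

section \<open>Sobolev calculus\<close>

lemma locally_integrable_lincomb:
  assumes "locally_integrable f" "locally_integrable g"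
  shows "locally_integrable (\<lambda>x. a * f x + b * g x)"
  using assms unfolding locally_integrable_def
  by (auto intro!: set_integral_add set_integrable_mult_right)

lemma L2_lincomb:
  assumes f: "f \<in> L2" and g: "g \<in> L2"
  shows "(\<lambda>x. a * f x + b * g x) \<in> L2"
proof -
  have [measurable]: "f \<in> borel_measurable borel" "g \<in> borel_measurable borel"
    using f g by (auto simp: L2_def)
  have "integrable lborel (\<lambda>x. 2 * a\<^sup>2 * (f x)\<^sup>2 + 2 * b\<^sup>2 * (g x)\<^sup>2)"
    using f g by (simp add: L2_def)
  then have "integrable lborel (\<lambda>x. (a * f x + b * g x)\<^sup>2)"
  proof (rule Bochner_Integration.integrable_bound)
    show "AE x in lborel. norm ((a * f x + b * g x)\<^sup>2) \<le> norm (2 * a\<^sup>2 * (f x)\<^sup>2 + 2 * b\<^sup>2 * (g x)\<^sup>2)"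
    proof (rule AE_I2)
      fix x
      have "(a * f x + b * g x)\<^sup>2 \<le> 2 * a\<^sup>2 * (f x)\<^sup>2 + 2 * b\<^sup>2 * (g x)\<^sup>2"
        using sum_squares_bound[of "a * f x" "b * g x"]
        by (simp add: power2_sum power_mult_distrib)
      then show "norm ((a * f x + b * g x)\<^sup>2) \<le> norm (2 * a\<^sup>2 * (f x)\<^sup>2 + 2 * b\<^sup>2 * (g x)\<^sup>2)"
        by simp
    qed
  qed measurable
  then show ?thesis by (simp add: L2_def)
qed

lemma L2_cong_AE:
  assumes "f \<in> L2" "AE x in lborel. f x = g x" "g \<in> borel_measurable borel"
  shows "g \<in> L2"
proof -
  have [measurable]: "f \<in> borel_measurable borel" "g \<in> borel_measurable borel"
    using assms by (auto simp: L2_def)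
  have "AE x in lborel. (f x)\<^sup>2 = (g x)\<^sup>2" using assms(2) by eventually_elim simp
  with assms show ?thesis
    by (auto simp: L2_def intro: integrable_cong_AE_imp)
qed

lemma is_weak_partial_lincomb:
  assumes "is_weak_partial i f f'" "is_weak_partial i g g'"
  shows "is_weak_partial i (\<lambda>x. a * f x + b * g x) (\<lambda>x. a * f' x + b * g' x)"
proof -
  have l: "locally_integrable f" "locally_integrable g" "locally_integrable f'" "locally_integrable g'"
    and w: "\<And>\<phi>. test_function \<phi> \<Longrightarrow> (LINT x|lborel. f x * partial i \<phi> x) = - (LINT x|lborel. f' x * \<phi> x)"
      "\<And>\<phi>. test_function \<phi> \<Longrightarrow> (LINT x|lborel. g x * partial i \<phi> x) = - (LINT x|lborel. g' x * \<phi> x)"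
    using assms by (auto simp: is_weak_partial_def)
  have lin: "(LINT x|lborel. (a * p x + b * q x) * \<phi> x) =
      a * (LINT x|lborel. p x * \<phi> x) + b * (LINT x|lborel. q x * \<phi> x)"
    if "locally_integrable p" "locally_integrable q" "test_function \<phi>" for p q \<phi>
    using integrable_mult_test_function[OF that(1,3)] integrable_mult_test_function[OF that(2,3)]
    by (simp add: distrib_right mult.assoc)
  show ?thesis
    unfolding is_weak_partial_def
    by (simp add: locally_integrable_lincomb l lin test_function_partial w)
qed

lemma is_weak_partial_zero: "is_weak_partial i (\<lambda>x. 0) (\<lambda>x. 0)"
  by (simp add: is_weak_partial_def locally_integrable_def set_integrable_def)

text \<open>The base functions may differ on a null set, because identities such as that between
  \<open>S\<close> and the strain of \<open>u\<close> hold only almost everywhere.\<close>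

lemma is_weak_partial_unique:
  assumes "is_weak_partial i f g" "is_weak_partial i f' g'" "AE x in lborel. f x = f' x"
  shows "AE x in lborel. g x = g' x"
proof -
  have l: "locally_integrable g" "locally_integrable g'" "locally_integrable f" "locally_integrable f'"
    using assms by (auto simp: is_weak_partial_def)
  have "AE x in lborel. 1 * g x + - 1 * g' x = 0"
  proof (rule integral_test_functions_zero_imp_AE_zero[OF locally_integrable_lincomb[OF l(1,2)]])
    fix \<phi> assume \<phi>: "test_function \<phi>"
    have "(LINT x|lborel. f x * partial i \<phi> x) = (LINT x|lborel. f' x * partial i \<phi> x)"
      using assms(3) l(3,4) test_function_partial[OF \<phi>, of i]
      by (intro integral_cong_AE) (auto intro!: borel_measurable_times
          simp: locally_integrable_measurable test_function_measurable)
    then have "(LINT x|lborel. g x * \<phi> x) = (LINT x|lborel. g' x * \<phi> x)"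
      using assms(1,2) \<phi> by (simp add: is_weak_partial_def)
    then show "(LINT x|lborel. (1 * g x + - 1 * g' x) * \<phi> x) = 0"
      using integrable_mult_test_function[OF l(1) \<phi>] integrable_mult_test_function[OF l(2) \<phi>]
      by (simp add: left_diff_distrib)
  qed
  then show ?thesis by simp
qed

lemma is_weak_partial_cong_AE:
  assumes W: "is_weak_partial i f g" and eq: "AE x in lborel. f x = f' x" and "f' \<in> borel_measurable borel"
  shows "is_weak_partial i f' g"
proof -
  have l: "locally_integrable f" "locally_integrable g"
    using W by (auto simp: is_weak_partial_def)
  note [measurable] = locally_integrable_measurable[OF l(1)] assms(3)
  have "locally_integrable f'"
  proof (rule locally_integrableI_cball[OF assms(3)])
    fix R
    have "(\<lambda>x. indicator (cball 0 R) x * f' x) \<in> borel_measurable lborel"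
      by (intro borel_measurable_times borel_measurable_indicator) (use assms(3) in auto)
    moreover have "AE x in lborel. indicator (cball 0 R) x * f x = indicator (cball 0 R) x * f' x"
      using eq by eventually_elim simp
    ultimately show "integrable lborel (\<lambda>x. indicator (cball 0 R) x * f' x)"
      using locally_integrable_cball[OF l(1)] integrable_cong_AE_imp by blast
  qed
  moreover have "(LINT x|lborel. f' x * partial i \<phi> x) = (LINT x|lborel. f x * partial i \<phi> x)"
    if "test_function \<phi>" for \<phi>
  proof -
    note [measurable] = test_function_measurable[OF test_function_partial[OF that, of i]]
    show ?thesis using eq by (intro integral_cong_AE) auto
  qed
  ultimately show ?thesis
    using W by (simp add: is_weak_partial_def)
qed

lemma is_weak_partial_weak_partial:
  "is_weak_partial i f g \<Longrightarrow> is_weak_partial i f (weak_partial i f)"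
  unfolding weak_partial_def using someI[of "is_weak_partial i f"] by blast

lemma weak_partial_AE_eq:
  "is_weak_partial i f g \<Longrightarrow> AE x in lborel. weak_partial i f x = g x"
  using is_weak_partial_unique is_weak_partial_weak_partial by blast

text \<open>Both sides are tested against \<phi>, whose partial derivatives commute. Stated for
  given derivatives rather than in \<open>H2\<close>, it also reaches the components of
  \<open>u\<close>, known here to be locally integrable.\<close>

lemma is_weak_partial_commute:
  assumes "is_weak_partial i f fi" "is_weak_partial j f fj"
    and "is_weak_partial j fi fij" "is_weak_partial i fj fji"
  shows "AE x in lborel. fij x = fji x"
proof -
  have l: "locally_integrable fij" "locally_integrable fji"
    using assms by (auto simp: is_weak_partial_def)
  have "AE x in lborel. 1 * fij x + - 1 * fji x = 0"
  proof (rule integral_test_functions_zero_imp_AE_zero[OF locally_integrable_lincomb[OF l]])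
    fix \<phi> assume \<phi>: "test_function \<phi>"
    have "(LINT x|lborel. fij x * \<phi> x) = (LINT x|lborel. f x * partial i (partial j \<phi>) x)"
      using assms \<phi> by (simp add: is_weak_partial_def test_function_partial)
    moreover have "(LINT x|lborel. fji x * \<phi> x) = (LINT x|lborel. f x * partial j (partial i \<phi>) x)"
      using assms \<phi> by (simp add: is_weak_partial_def test_function_partial)
    ultimately have "(LINT x|lborel. fij x * \<phi> x) = (LINT x|lborel. fji x * \<phi> x)"
      by (simp add: partial_commute[OF test_function_smooth[OF \<phi>], of i j])
    then show "(LINT x|lborel. (1 * fij x + - 1 * fji x) * \<phi> x) = 0"
      using integrable_mult_test_function[OF l(1) \<phi>] integrable_mult_test_function[OF l(2) \<phi>]
      by (simp add: left_diff_distrib)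
  qed
  then show ?thesis by simp
qed

lemma weak_partial_in_L2:
  assumes "is_weak_partial i f g" "g \<in> L2"
  shows "weak_partial i f \<in> L2"
proof (rule L2_cong_AE[OF assms(2)])
  show "AE x in lborel. g x = weak_partial i f x"
    using weak_partial_AE_eq[OF assms(1)] by eventually_elim simp
  show "weak_partial i f \<in> borel_measurable borel"
    using is_weak_partial_weak_partial[OF assms(1)]
    by (simp add: is_weak_partial_def locally_integrable_measurable)
qed

section \<open>The Sobolev spaces through chosen derivatives\<close>

lemma H1_iff:
  "f \<in> H1 \<longleftrightarrow> f \<in> L2 \<and> (\<forall>i. is_weak_partial i f (weak_partial i f) \<and> weak_partial i f \<in> L2)"
  unfolding H1_def using is_weak_partial_weak_partial weak_partial_in_L2 by blast

lemma H1_L2: "f \<in> H1 \<Longrightarrow> f \<in> L2"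
  by (simp add: H1_def)

lemma H1_weak_partial: "f \<in> H1 \<Longrightarrow> is_weak_partial i f (weak_partial i f)"
  by (simp add: H1_iff)

lemma H1_measurable: "f \<in> H1 \<Longrightarrow> f \<in> borel_measurable borel"
  by (simp add: H1_def L2_def)

lemma H1_cong_AE:
  assumes "f \<in> H1" "AE x in lborel. f x = g x" "g \<in> borel_measurable borel"
  shows "g \<in> H1"
  using assms is_weak_partial_cong_AE L2_cong_AE unfolding H1_def by fast

lemma H1_lincomb:
  assumes "f \<in> H1" "g \<in> H1"
  shows "(\<lambda>x. a * f x + b * g x) \<in> H1"
  using assms is_weak_partial_lincomb L2_lincomb unfolding H1_iff[of f] H1_iff[of g]
  by (simp (no_asm) add: H1_def) blast

lemma H2_iff: "f \<in> H2 \<longleftrightarrow> f \<in> H1 \<and> (\<forall>i. weak_partial i f \<in> H1)"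
proof
  assume f: "f \<in> H2"
  have "weak_partial i f \<in> H1" for i
  proof -
    obtain g where g: "g \<in> H1" "is_weak_partial i f g" using f by (auto simp: H2_def)
    show ?thesis
    proof (rule H1_cong_AE[OF g(1)])
      show "AE x in lborel. g x = weak_partial i f x"
        using weak_partial_AE_eq[OF g(2)] by eventually_elim simp
      show "weak_partial i f \<in> borel_measurable borel"
        using is_weak_partial_weak_partial[OF g(2)]
        by (simp add: is_weak_partial_def locally_integrable_measurable)
    qed
  qed
  with f show "f \<in> H1 \<and> (\<forall>i. weak_partial i f \<in> H1)" by (simp add: H2_def)
next
  assume "f \<in> H1 \<and> (\<forall>i. weak_partial i f \<in> H1)"
  then show "f \<in> H2" using H1_weak_partial by (auto simp: H2_def)
qed

lemma H2_H1: "f \<in> H2 \<Longrightarrow> f \<in> H1"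
  by (simp add: H2_iff)

lemma H2_weak_partial_H1: "f \<in> H2 \<Longrightarrow> weak_partial i f \<in> H1"
  by (simp add: H2_iff)

lemma H2_lincomb:
  assumes "f \<in> H2" "g \<in> H2"
  shows "(\<lambda>x. a * f x + b * g x) \<in> H2"
proof -
  have "is_weak_partial i (\<lambda>x. a * f x + b * g x) (\<lambda>x. a * weak_partial i f x + b * weak_partial i g x)" for i
    using assms by (intro is_weak_partial_lincomb H1_weak_partial H2_H1)
  moreover have "(\<lambda>x. a * weak_partial i f x + b * weak_partial i g x) \<in> H1" for i
    using assms by (intro H1_lincomb H2_weak_partial_H1)
  ultimately show ?thesis
    using assms H1_lincomb by (auto simp: H2_def)
qed

lemma weak_partial_lincomb:
  assumes "f \<in> H1" "g \<in> H1"
  shows "AE x in lborel. weak_partial i (\<lambda>x. a * f x + b * g x) x =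
    a * weak_partial i f x + b * weak_partial i g x"
  using assms by (intro weak_partial_AE_eq is_weak_partial_lincomb H1_weak_partial)

text \<open>Identities between derivatives hold almost everywhere and cannot be substituted directly
  under a further \<open>weak_partial\<close>; this lemma takes them there.\<close>

lemma weak_partial_cong_AE:
  assumes "f \<in> H1" "g \<in> H1" "AE x in lborel. f x = g x"
  shows "AE x in lborel. weak_partial i f x = weak_partial i g x"
  by (rule is_weak_partial_unique[OF H1_weak_partial[OF assms(1)] H1_weak_partial[OF assms(2)] assms(3)])

lemma weak_partial_commute:
  assumes "f \<in> H2"
  shows "AE x in lborel. weak_partial i (weak_partial j f) x = weak_partial j (weak_partial i f) x"
  using assms
  by (intro is_weak_partial_commute[of j f "weak_partial j f" i "weak_partial i f"]
      H1_weak_partial H2_H1 H2_weak_partial_H1)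

lemma H1_diff: "f \<in> H1 \<Longrightarrow> g \<in> H1 \<Longrightarrow> (\<lambda>x. f x - g x) \<in> H1"
  using H1_lincomb[of f g 1 "-1"] by simp

lemma H2_diff: "f \<in> H2 \<Longrightarrow> g \<in> H2 \<Longrightarrow> (\<lambda>x. f x - g x) \<in> H2"
  using H2_lincomb[of f g 1 "-1"] by simp

lemma weak_partial_diff:
  "f \<in> H1 \<Longrightarrow> g \<in> H1 \<Longrightarrow>
    AE x in lborel. weak_partial i (\<lambda>x. f x - g x) x = weak_partial i f x - weak_partial i g x"
  using weak_partial_lincomb[of f g i 1 "-1"] by simp

lemma H1_add: "f \<in> H1 \<Longrightarrow> g \<in> H1 \<Longrightarrow> (\<lambda>x. f x + g x) \<in> H1"
  using H1_lincomb[of f g 1 1] by simp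

lemma weak_partial_add:
  "f \<in> H1 \<Longrightarrow> g \<in> H1 \<Longrightarrow>
    AE x in lborel. weak_partial i (\<lambda>x. f x + g x) x = weak_partial i f x + weak_partial i g x"
  using weak_partial_lincomb[of f g i 1 1] by simp

lemma H1_zero: "(\<lambda>x. 0) \<in> H1"
proof -
  have "(\<lambda>x. 0) \<in> L2" by (simp add: L2_def)
  then show ?thesis unfolding H1_def using is_weak_partial_zero by blast
qed

lemma H1_sum: "(\<And>k. k \<in> A \<Longrightarrow> f k \<in> H1) \<Longrightarrow> (\<lambda>x. \<Sum>k\<in>A. f k x) \<in> H1"
  by (induction A rule: infinite_finite_induct) (simp_all add: H1_zero H1_add)

lemma weak_partial_zero: "AE x in lborel. weak_partial i (\<lambda>x. 0) x = 0"
  by (rule weak_partial_AE_eq[OF is_weak_partial_zero])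

lemma weak_partial_sum:
  "(\<And>k. k \<in> A \<Longrightarrow> f k \<in> H1) \<Longrightarrow>
    AE x in lborel. weak_partial i (\<lambda>x. \<Sum>k\<in>A. f k x) x = (\<Sum>k\<in>A. weak_partial i (f k) x)"
proof (induction A rule: infinite_finite_induct)
  case (insert a A)
  then have "AE x in lborel. weak_partial i (\<lambda>x. f a x + (\<Sum>k\<in>A. f k x)) x =
      weak_partial i (f a) x + weak_partial i (\<lambda>x. \<Sum>k\<in>A. f k x) x"
    by (intro weak_partial_add H1_sum) auto
  moreover have "AE x in lborel. weak_partial i (\<lambda>x. \<Sum>k\<in>A. f k x) x = (\<Sum>k\<in>A. weak_partial i (f k) x)"
    using insert by auto
  ultimately show ?case
    by eventually_elim (simp add: insert)
qed (simp_all add: weak_partial_zero)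

section \<open>Integrability of triple products\<close>

lemma nn_integral_L2_finite: "f \<in> L2 \<Longrightarrow> (\<integral>\<^sup>+x. ennreal ((f x)\<^sup>2) \<partial>lborel) < \<infinity>"
  by (simp add: L2_def integrable_iff_bounded)

lemma H1_integrable_power4:
  assumes f: "f \<in> H1"
  shows "integrable lborel (\<lambda>x. (f x)^4)"
proof (rule integrableI_bounded)
  have [measurable]: "f \<in> borel_measurable borel" by (rule H1_measurable[OF f])
  show "(\<lambda>x. (f x)^4) \<in> borel_measurable lborel" by measurable
  have "(\<integral>\<^sup>+x. ennreal ((f x)^4) \<partial>lborel) < \<infinity>"
    using f unfolding H1_iff
    by (intro Ladyzhenskaya_finite[where g="\<lambda>i. weak_partial i f"]
        weak_partial_imp_abs_cont_lines nn_integral_L2_finite) blast+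
  then show "(\<integral>\<^sup>+x. ennreal (norm ((f x)^4)) \<partial>lborel) < \<infinity>" by simp
qed

text \<open>Hoelder with exponents 2, 4, 4 in elementary form: 2xy \<le> x^2 + y^2, used twice,
  bounds the product by a^2 + b^4 + c^4.\<close>

lemma integrable_mult_L2_H1_H1:
  assumes a: "a \<in> L2" and b: "b \<in> H1" and c: "c \<in> H1"
  shows "integrable lborel (\<lambda>x. a x * b x * c x)"
proof -
  have [measurable]: "a \<in> borel_measurable borel" "b \<in> borel_measurable borel" "c \<in> borel_measurable borel"
    using a b c by (auto simp: L2_def H1_measurable)
  have "integrable lborel (\<lambda>x. (a x)\<^sup>2 + (b x)^4 + (c x)^4)"
    using a H1_integrable_power4[OF b] H1_integrable_power4[OF c] by (simp add: L2_def)
  then show ?thesis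
  proof (rule Bochner_Integration.integrable_bound)
    show "AE x in lborel. norm (a x * b x * c x) \<le> norm ((a x)\<^sup>2 + (b x)^4 + (c x)^4)"
    proof (rule AE_I2)
      fix x
      have "2 * (\<bar>a x\<bar> * \<bar>b x * c x\<bar>) \<le> (a x)\<^sup>2 + (b x * c x)\<^sup>2"
        using sum_squares_bound[of "\<bar>a x\<bar>" "\<bar>b x * c x\<bar>"] by (simp add: mult.assoc)
      moreover have "2 * (b x * c x)\<^sup>2 \<le> (b x)^4 + (c x)^4"
        using sum_squares_bound[of "(b x)\<^sup>2" "(c x)\<^sup>2"] by (simp add: power_mult_distrib mult.assoc)
      moreover have "0 \<le> (a x)\<^sup>2" "0 \<le> (b x)^4" "0 \<le> (c x)^4" by simp_all
      ultimately have "\<bar>a x\<bar> * \<bar>b x * c x\<bar> \<le> (a x)\<^sup>2 + (b x)^4 + (c x)^4"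
        by linarith
      then show "norm (a x * b x * c x) \<le> norm ((a x)\<^sup>2 + (b x)^4 + (c x)^4)"
        by (simp add: abs_mult mult.assoc)
    qed
  qed measurable
qed

text \<open>Each term of \<open>E\<close> has one factor in L2 and two in \<open>H1\<close>, and the
  undifferentiated product fits the same pattern. Both are therefore integrable, as the translation
  argument requires.\<close>

lemma integral_triple_product_derivative:
  fixes i :: 3
  assumes f: "f \<in> H1" and g: "g \<in> H1" and h: "h \<in> H1"
  defines "E \<equiv> \<lambda>x. weak_partial i f x * g x * h x + f x * weak_partial i g x * h x + f x * g x * weak_partial i h x"
  shows "has_bochner_integral lborel E 0"
proof -
  note ac = weak_partial_imp_abs_cont_lines[OF H1_weak_partial]
  have ac3: "abs_cont_lines i (\<lambda>x. f x * g x * h x) E"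
  proof -
    have "(\<lambda>x. f x * g x * weak_partial i h x + (f x * weak_partial i g x + weak_partial i f x * g x) * h x) = E"
      by (auto simp: E_def algebra_simps)
    with abs_cont_lines_mult[OF abs_cont_lines_mult[OF ac[OF f, of i] ac[OF g]] ac[OF h]]
    show ?thesis by simp
  qed
  have d: "weak_partial i f \<in> L2" "weak_partial i g \<in> L2" "weak_partial i h \<in> L2"
    using f g h by (auto simp: H1_iff)
  have "integrable lborel (\<lambda>x. f x * g x * h x)"
    by (rule integrable_mult_L2_H1_H1[OF H1_L2[OF f] g h])
  moreover have E: "integrable lborel E"
  proof -
    have "integrable lborel (\<lambda>x. weak_partial i f x * g x * h x + weak_partial i g x * f x * h x + weak_partial i h x * f x * g x)"
      using integrable_mult_L2_H1_H1[OF d(1) g h] integrable_mult_L2_H1_H1[OF d(2) f h]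
        integrable_mult_L2_H1_H1[OF d(3) f g] by simp
    then show ?thesis by (simp add: E_def mult_ac)
  qed
  ultimately show ?thesis
    using integral_derivative_eq_0[OF ac3] by (simp add: has_bochner_integral_iff)
qed

section \<open>Strain and vorticity\<close>

text \<open>Here \<open>p i j\<close> and \<open>q i j\<close> stand for \<partial>_i of the j-th
  component of the vorticity \<open>o'\<close> and of \<open>w\<close>. The two groups on the right
  are the expanded derivatives of w_j o'_j o'_i and w_i o'_j o'_j. Zero traces remove the divergence
  terms; the rest pairs w_j o'_i with the antisymmetric part of \<open>p\<close>, which acts as a
  cross product with \<open>w\<close>, and so vanishes.\<close>

lemma strain_curl_pointwise:
  fixes p q :: "3 \<Rightarrow> 3 \<Rightarrow> real" and o' w :: "3 \<Rightarrow> real"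
  assumes "(\<Sum>i\<in>UNIV. p i i) = 0" "(\<Sum>i\<in>UNIV. q i i) = 0"
    and "w 1 = p 2 3 - p 3 2" "w 2 = p 3 1 - p 1 3" "w 3 = p 1 2 - p 2 1"
  shows "(\<Sum>i\<in>UNIV. \<Sum>j\<in>UNIV. q i j * o' i * o' j) =
    (\<Sum>i\<in>UNIV. \<Sum>j\<in>UNIV. (q i j * o' j * o' i + w j * p i j * o' i + w j * o' j * p i i)
      - (1/2) * (q i i * o' j * o' j + w i * p i j * o' j + w i * o' j * p i j))"
proof -
  \<comment> \<open>Eliminating one diagonal entry of each matrix turns the claim into a polynomial
    identity in free variables.\<close>
  have p: "p 3 3 = - p 1 1 - p 2 2" and q: "q 3 3 = - q 1 1 - q 2 2"
    using assms(1,2) by (simp_all add: sum_3)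
  show ?thesis
    unfolding sum_3 assms(3-5) p q by (simp add: algebra_simps)
qed

locale velocity_strain =
  fixes u :: "R3 \<Rightarrow> real^3" and S :: "R3 \<Rightarrow> real^3^3"
  assumes u: "\<And>i j. \<exists>g\<in>L2. is_weak_partial i (\<lambda>x. u x $ j) g"
    and div: "AE x in lborel. divergence u x = 0"
    and S: "\<And>i j. (\<lambda>x. S x $ i $ j) \<in> H2"
    and strain: "AE x in lborel. S x = sym_grad u x"
begin

section \<open>Regularity of the velocity gradient\<close>

definition U :: "3 \<Rightarrow> 3 \<Rightarrow> R3 \<Rightarrow> real" where
  "U i j = weak_partial i (\<lambda>x. u x $ j)"

lemma U: "is_weak_partial i (\<lambda>x. u x $ j) (U i j)" "U i j \<in> L2"
  using u[of i j] is_weak_partial_weak_partial weak_partial_in_L2 unfolding U_def by blast+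

lemma S_eq: "AE x in lborel. S x $ i $ j = 1/2 * (U i j x + U j i x)"
  using strain by eventually_elim (simp add: sym_grad_def U_def)

text \<open>Second derivatives of \<open>u\<close> are not yet known to be functions, so both
  derivatives are put on \<phi>. The two signs, one from \<open>S\<close> and one from
  \<open>U\<close>, cancel.\<close>

lemma integral_weak_partial_S:
  assumes \<phi>: "test_function \<phi>"
  shows "(LINT x|lborel. weak_partial k (\<lambda>x. S x $ i $ j) x * \<phi> x) =
    1/2 * ((LINT x|lborel. u x $ j * partial i (partial k \<phi>) x) +
           (LINT x|lborel. u x $ i * partial j (partial k \<phi>) x))"
proof -
  note p\<phi> = test_function_partial[OF \<phi>, of k]
  have l: "locally_integrable (U i j)" for i j
    using U(1) by (simp add: is_weak_partial_def)
  have [measurable]: "U i j \<in> borel_measurable borel" "(\<lambda>x. S x $ i $ j) \<in> borel_measurable borel" for i j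
    using l locally_integrable_measurable H1_measurable[OF H2_H1[OF S]] by auto
  note [measurable] = test_function_measurable[OF p\<phi>]
  have "(LINT x|lborel. weak_partial k (\<lambda>x. S x $ i $ j) x * \<phi> x) =
      - (LINT x|lborel. S x $ i $ j * partial k \<phi> x)"
    using H1_weak_partial[OF H2_H1[OF S], of k i j] \<phi> by (simp add: is_weak_partial_def)
  also have "(LINT x|lborel. S x $ i $ j * partial k \<phi> x) =
      (LINT x|lborel. 1/2 * (U i j x * partial k \<phi> x + U j i x * partial k \<phi> x))"
  proof (rule integral_cong_AE)
    show "AE x in lborel. S x $ i $ j * partial k \<phi> x = 1/2 * (U i j x * partial k \<phi> x + U j i x * partial k \<phi> x)"
      using S_eq[of i j] by eventually_elim (simp add: algebra_simps)
  qed measurable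
  also have "\<dots> = 1/2 * ((LINT x|lborel. U i j x * partial k \<phi> x) + (LINT x|lborel. U j i x * partial k \<phi> x))"
    using integrable_mult_test_function[OF l p\<phi>] by simp
  finally show ?thesis
    using U(1) p\<phi> by (simp add: is_weak_partial_def add_divide_distrib)
qed

text \<open>The identity is checked against test functions: of the six second derivative terms four
  cancel once the derivatives of \<phi> commute, and the two remaining halves add up. The
  coefficients 1 and -1 keep the shape of the lemmas on linear combinations.\<close>

lemma is_weak_partial_U:
  "is_weak_partial j (U k i) (\<lambda>x. 1 * (1 * weak_partial j (\<lambda>x. S x $ i $ k) x + 1 * weak_partial k (\<lambda>x. S x $ i $ j) x)
     + - 1 * weak_partial i (\<lambda>x. S x $ j $ k) x)"
proof -
  have l: "locally_integrable (weak_partial k (\<lambda>x. S x $ i $ j))" for i j k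
    using H1_weak_partial[OF H2_H1[OF S]] by (simp add: is_weak_partial_def)
  show ?thesis
    unfolding is_weak_partial_def
  proof (intro conjI allI impI)
    show "locally_integrable (U k i)"
      using U(1) by (simp add: is_weak_partial_def)
    show "locally_integrable (\<lambda>x. 1 * (1 * weak_partial j (\<lambda>x. S x $ i $ k) x + 1 * weak_partial k (\<lambda>x. S x $ i $ j) x)
       + - 1 * weak_partial i (\<lambda>x. S x $ j $ k) x)"
      by (intro locally_integrable_lincomb l)
    fix \<phi> assume \<phi>: "test_function \<phi>"
    note c = partial_commute[OF test_function_smooth[OF \<phi>]]
    have "(LINT x|lborel. U k i x * partial j \<phi> x) = - (LINT x|lborel. u x $ i * partial k (partial j \<phi>) x)"
      using U(1)[of k i] test_function_partial[OF \<phi>, of j] by (simp add: is_weak_partial_def)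
    moreover have "(LINT x|lborel. (1 * (1 * weak_partial j (\<lambda>x. S x $ i $ k) x + 1 * weak_partial k (\<lambda>x. S x $ i $ j) x)
       + - 1 * weak_partial i (\<lambda>x. S x $ j $ k) x) * \<phi> x) =
      (LINT x|lborel. weak_partial j (\<lambda>x. S x $ i $ k) x * \<phi> x) + (LINT x|lborel. weak_partial k (\<lambda>x. S x $ i $ j) x * \<phi> x)
        - (LINT x|lborel. weak_partial i (\<lambda>x. S x $ j $ k) x * \<phi> x)"
      using integrable_mult_test_function[OF l \<phi>] by (simp add: distrib_right left_diff_distrib)
    ultimately show "(LINT x|lborel. U k i x * partial j \<phi> x) =
      - (LINT x|lborel. (1 * (1 * weak_partial j (\<lambda>x. S x $ i $ k) x + 1 * weak_partial k (\<lambda>x. S x $ i $ j) x)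
       + - 1 * weak_partial i (\<lambda>x. S x $ j $ k) x) * \<phi> x)"
      by (simp add: integral_weak_partial_S[OF \<phi>] c[of i j] c[of i k] c[of j k]
          add_divide_distrib)
  qed
qed

text \<open>The full gradient inherits the regularity of its symmetric part without singular
  integrals: \<open>U\<close> is in L2 by assumption on \<open>u\<close>, and its derivatives are
  combinations of those of \<open>S\<close>, hence in \<open>H1\<close>.\<close>

lemma U_H2: "U k i \<in> H2"
proof -
  have "(\<lambda>x. 1 * (1 * weak_partial j (\<lambda>x. S x $ i $ k) x + 1 * weak_partial k (\<lambda>x. S x $ i $ j) x)
     + - 1 * weak_partial i (\<lambda>x. S x $ j $ k) x) \<in> H1" for j
    by (intro H1_lincomb H2_weak_partial_H1 S)
  then show ?thesis
    unfolding H2_def H1_def[of] using U(2) is_weak_partial_U H1_L2 by blast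
qed

text \<open>The commutation lemma is applied to the component of \<open>u\<close>, of which both
  \<open>U k i\<close> and \<open>U j i\<close> are first derivatives.\<close>

lemma weak_partial_U_commute: "AE x in lborel. weak_partial j (U k i) x = weak_partial k (U j i) x"
  by (rule is_weak_partial_commute[OF U(1) U(1) H1_weak_partial[OF H2_H1[OF U_H2]]
        H1_weak_partial[OF H2_H1[OF U_H2]]])

section \<open>The vorticity and its curl\<close>

abbreviation \<omega> :: "3 \<Rightarrow> R3 \<Rightarrow> real" where
  "\<omega> i x \<equiv> curl u x $ i"

lemma \<omega>_eq:
  "\<omega> 1 = (\<lambda>x. U 2 3 x - U 3 2 x)" "\<omega> 2 = (\<lambda>x. U 3 1 x - U 1 3 x)" "\<omega> 3 = (\<lambda>x. U 1 2 x - U 2 1 x)"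
  by (auto simp: curl_def U_def)

lemma \<omega>_H2: "\<omega> i \<in> H2"
proof -
  have "\<forall>i. \<omega> i \<in> H2"
    unfolding forall_3 \<omega>_eq by (intro conjI H2_diff U_H2)
  then show ?thesis ..
qed

definition w :: "3 \<Rightarrow> R3 \<Rightarrow> real" where
  "w i x = (vector [weak_partial 2 (\<omega> 3) x - weak_partial 3 (\<omega> 2) x,
     weak_partial 3 (\<omega> 1) x - weak_partial 1 (\<omega> 3) x,
     weak_partial 1 (\<omega> 2) x - weak_partial 2 (\<omega> 1) x] :: real^3) $ i"

lemma w_eq:
  "w 1 = (\<lambda>x. weak_partial 2 (\<omega> 3) x - weak_partial 3 (\<omega> 2) x)"
  "w 2 = (\<lambda>x. weak_partial 3 (\<omega> 1) x - weak_partial 1 (\<omega> 3) x)"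
  "w 3 = (\<lambda>x. weak_partial 1 (\<omega> 2) x - weak_partial 2 (\<omega> 1) x)"
  by (auto simp: w_def)

lemma w_H1: "w i \<in> H1"
proof -
  have "\<forall>i. w i \<in> H1"
    unfolding forall_3 w_eq by (intro conjI H1_diff H2_weak_partial_H1 \<omega>_H2)
  then show ?thesis ..
qed

lemma div_\<omega>: "AE x in lborel. (\<Sum>i\<in>UNIV. weak_partial i (\<omega> i) x) = 0"
proof -
  note d = weak_partial_diff[OF H2_H1[OF U_H2] H2_H1[OF U_H2]]
  show ?thesis
    unfolding \<omega>_eq sum_3
    \<comment> \<open>The six second derivatives cancel in pairs, one pair for each component of
      \<open>u\<close>.\<close>
    using d[of 1 2 3 3 2] d[of 2 3 1 1 3] d[of 3 1 2 2 1]
      weak_partial_U_commute[of 1 2 3] weak_partial_U_commute[of 1 3 2] weak_partial_U_commute[of 2 3 1]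
    by eventually_elim simp
qed

lemma div_w: "AE x in lborel. (\<Sum>i\<in>UNIV. weak_partial i (w i) x) = 0"
proof -
  note d = weak_partial_diff[OF H2_weak_partial_H1[OF \<omega>_H2] H2_weak_partial_H1[OF \<omega>_H2]]
  note c = weak_partial_commute[OF \<omega>_H2]
  show ?thesis
    unfolding w_eq sum_3
    using d[of 1 2 3 3 2] d[of 2 3 1 1 3] d[of 3 1 2 2 1] c[of 1 2 3] c[of 1 3 2] c[of 2 3 1]
    by eventually_elim simp
qed

lemma weak_partial_div: "AE x in lborel. (\<Sum>k\<in>UNIV. weak_partial i (U k k) x) = 0"
proof -
  have s: "AE x in lborel. weak_partial i (\<lambda>x. \<Sum>k\<in>UNIV. U k k x) x = (\<Sum>k\<in>UNIV. weak_partial i (U k k) x)"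
    by (intro weak_partial_sum H2_H1 U_H2)
  have "AE x in lborel. (\<Sum>k\<in>UNIV. U k k x) = 0"
    using div by (simp add: divergence_def U_def)
  then have "AE x in lborel. weak_partial i (\<lambda>x. \<Sum>k\<in>UNIV. U k k x) x = weak_partial i (\<lambda>x. 0) x"
    by (intro weak_partial_cong_AE H1_sum H1_zero H2_H1 U_H2)
  with s weak_partial_zero[of i] show ?thesis
    by eventually_elim simp
qed

text \<open>The identity curl curl = grad div - Laplacian, in which \<open>weak_partial_div\<close>
  removes the gradient of the divergence.\<close>

lemma w_eq_minus_laplacian: "AE x in lborel. (\<Sum>k\<in>UNIV. weak_partial k (U k j) x) = - w j x"
proof -
  note d = weak_partial_diff[OF H2_H1[OF U_H2] H2_H1[OF U_H2]]
  note c = weak_partial_U_commute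
  have "\<forall>j. AE x in lborel. (\<Sum>k\<in>UNIV. weak_partial k (U k j) x) = - w j x"
    unfolding forall_3 w_eq \<omega>_eq sum_3
  proof (intro conjI)
    show "AE x in lborel. weak_partial 1 (U 1 1) x + weak_partial 2 (U 2 1) x + weak_partial 3 (U 3 1) x =
      - (weak_partial 2 (\<lambda>x. U 1 2 x - U 2 1 x) x - weak_partial 3 (\<lambda>x. U 3 1 x - U 1 3 x) x)"
      using d[of 2 1 2 2 1] d[of 3 3 1 1 3] c[of 2 1 2] c[of 3 1 3] weak_partial_div[of 1]
      by eventually_elim (simp add: sum_3)
    show "AE x in lborel. weak_partial 1 (U 1 2) x + weak_partial 2 (U 2 2) x + weak_partial 3 (U 3 2) x =
      - (weak_partial 3 (\<lambda>x. U 2 3 x - U 3 2 x) x - weak_partial 1 (\<lambda>x. U 1 2 x - U 2 1 x) x)"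
      using d[of 3 2 3 3 2] d[of 1 1 2 2 1] c[of 3 2 3] c[of 1 2 1] weak_partial_div[of 2]
      by eventually_elim (simp add: sum_3)
    show "AE x in lborel. weak_partial 1 (U 1 3) x + weak_partial 2 (U 2 3) x + weak_partial 3 (U 3 3) x =
      - (weak_partial 1 (\<lambda>x. U 3 1 x - U 1 3 x) x - weak_partial 2 (\<lambda>x. U 2 3 x - U 3 2 x) x)"
      using d[of 1 3 1 1 3] d[of 2 2 3 3 2] c[of 1 3 1] c[of 2 3 2] weak_partial_div[of 3]
      by eventually_elim (simp add: sum_3)
  qed
  then show ?thesis ..
qed

section \<open>The Laplacian of the strain\<close>

lemma laplacian_U: "AE x in lborel. (\<Sum>k\<in>UNIV. weak_partial k (weak_partial k (U i j)) x) = - weak_partial i (w j) x"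
proof -
  have H: "weak_partial k (U i j) \<in> H1" for i j k
    by (intro H2_weak_partial_H1 U_H2)
  \<comment> \<open>The derivative in direction \<open>i\<close> moves outwards by two exchanges:
    the first uses that \<open>U\<close> is a derivative of \<open>u\<close>, the second that
    \<open>U k j\<close> is in \<open>H2\<close>.\<close>
  have "AE x in lborel. weak_partial k (weak_partial k (U i j)) x = weak_partial i (weak_partial k (U k j)) x" for k
    using weak_partial_cong_AE[OF H H weak_partial_U_commute, of k k i j] weak_partial_commute[OF U_H2, of k i k j]
    by eventually_elim simp
  then have 1: "AE x in lborel. \<forall>k\<in>UNIV. weak_partial k (weak_partial k (U i j)) x = weak_partial i (weak_partial k (U k j)) x"
    by (intro AE_finite_allI) auto
  have 2: "AE x in lborel. weak_partial i (\<lambda>x. \<Sum>k\<in>UNIV. weak_partial k (U k j) x) x =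
      (\<Sum>k\<in>UNIV. weak_partial i (weak_partial k (U k j)) x)"
    by (intro weak_partial_sum H)
  have "(\<lambda>x. - w j x) \<in> H1"
    using H1_lincomb[OF w_H1[of j] H1_zero, of "-1" 0] by simp
  then have 3: "AE x in lborel. weak_partial i (\<lambda>x. \<Sum>k\<in>UNIV. weak_partial k (U k j) x) x = weak_partial i (\<lambda>x. - w j x) x"
    by (intro weak_partial_cong_AE H1_sum H w_eq_minus_laplacian)
  have 4: "AE x in lborel. weak_partial i (\<lambda>x. - w j x) x = - weak_partial i (w j) x"
    using weak_partial_lincomb[OF w_H1[of j] H1_zero, of i "-1" 0] by simp
  from 1 2 3 4 show ?thesis by eventually_elim simp
qed

text \<open>The Laplacian commutes with the symmetric gradient and takes \<open>u\<close> to
  -w.\<close>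

lemma laplacian_S: "AE x in lborel. laplacian S x $ i $ j = - (1/2) * (weak_partial i (w j) x + weak_partial j (w i) x)"
proof -
  note UU = H2_H1[OF U_H2]
  have "AE x in lborel. weak_partial k (weak_partial k (\<lambda>x. S x $ i $ j)) x =
     1/2 * weak_partial k (weak_partial k (U i j)) x + 1/2 * weak_partial k (weak_partial k (U j i)) x" for k
  proof -
    have SU: "AE x in lborel. S x $ i $ j = 1/2 * U i j x + 1/2 * U j i x"
      using S_eq[of i j] by eventually_elim simp
    have "AE x in lborel. weak_partial k (\<lambda>x. S x $ i $ j) x = weak_partial k (\<lambda>x. 1/2 * U i j x + 1/2 * U j i x) x"
      by (intro weak_partial_cong_AE H2_H1 S H1_lincomb U_H2 SU)
    then have "AE x in lborel. weak_partial k (\<lambda>x. S x $ i $ j) x = 1/2 * weak_partial k (U i j) x + 1/2 * weak_partial k (U j i) x"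
      using weak_partial_lincomb[OF UU UU, of k "1/2" i j "1/2" j i] by eventually_elim simp
    then have "AE x in lborel. weak_partial k (weak_partial k (\<lambda>x. S x $ i $ j)) x =
       weak_partial k (\<lambda>x. 1/2 * weak_partial k (U i j) x + 1/2 * weak_partial k (U j i) x) x"
      by (intro weak_partial_cong_AE H1_lincomb H2_weak_partial_H1 S U_H2)
    moreover have "AE x in lborel. weak_partial k (\<lambda>x. 1/2 * weak_partial k (U i j) x + 1/2 * weak_partial k (U j i) x) x =
       1/2 * weak_partial k (weak_partial k (U i j)) x + 1/2 * weak_partial k (weak_partial k (U j i)) x"
      by (intro weak_partial_lincomb H2_weak_partial_H1 U_H2)
    ultimately show ?thesis by eventually_elim simp
  qed
  then have "AE x in lborel. \<forall>k\<in>UNIV. weak_partial k (weak_partial k (\<lambda>x. S x $ i $ j)) x =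
     1/2 * weak_partial k (weak_partial k (U i j)) x + 1/2 * weak_partial k (weak_partial k (U j i)) x"
    by (intro AE_finite_allI) auto
  with laplacian_U[of i j] laplacian_U[of j i] show ?thesis
    by eventually_elim (simp add: laplacian_def sum.distrib add_divide_distrib flip: sum_distrib_left sum_divide_distrib)
qed

lemma strain_laplacian_integral:
  "has_bochner_integral lborel (\<lambda>x. (- laplacian S x) \<bullet> tensor (curl u x) (curl u x)) 0"
proof -
  define E where "E f g h i x = weak_partial i f x * g x * h x + f x * weak_partial i g x * h x + f x * g x * weak_partial i h x"
    for f g h :: "R3 \<Rightarrow> real" and i x
  have E: "has_bochner_integral lborel (E f g h i) 0" if "f \<in> H1" "g \<in> H1" "h \<in> H1" for f g h i
    using integral_triple_product_derivative[OF that, of i] by (simp add: E_def[abs_def])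
  \<comment> \<open>The divergence of the vector field, arranged as derivatives of triple products
    so that each summand integrates to 0.\<close>
  define R where "R x = (\<Sum>i\<in>UNIV. \<Sum>j\<in>UNIV. E (w j) (\<omega> j) (\<omega> i) i x - 1/2 * E (w i) (\<omega> j) (\<omega> j) i x)" for x
  have "has_bochner_integral lborel R (\<Sum>i::3\<in>UNIV. \<Sum>j::3\<in>UNIV. 0 - 1/2 * 0)"
    unfolding R_def
    by (intro has_bochner_integral_sum has_bochner_integral_diff has_bochner_integral_mult_right E w_H1 H2_H1 \<omega>_H2)
  then have R: "has_bochner_integral lborel R 0" by simp
  have "AE x in lborel. \<forall>i\<in>UNIV. \<forall>j\<in>UNIV. laplacian S x $ i $ j = - (1/2) * (weak_partial i (w j) x + weak_partial j (w i) x)"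
    by (intro AE_finite_allI laplacian_S) auto
  with div_\<omega> div_w have ae: "AE x in lborel. R x = (- laplacian S x) \<bullet> tensor (curl u x) (curl u x)"
  proof eventually_elim
    case (elim x)
    let ?q = "\<lambda>i j. weak_partial i (w j) x"
    have "(- laplacian S x) \<bullet> tensor (curl u x) (curl u x) =
        (\<Sum>i\<in>UNIV. \<Sum>j\<in>UNIV. 1/2 * (?q i j + ?q j i) * (\<omega> i x * \<omega> j x))"
      using elim(3) by (simp add: inner_vec_def tensor_def)
    \<comment> \<open>The tensor square of \<omega> is symmetric, so the symmetric gradient of
      \<open>w\<close> may be replaced by the full one.\<close>
    also have "\<dots> = (\<Sum>i\<in>UNIV. \<Sum>j\<in>UNIV. ?q i j * \<omega> i x * \<omega> j x)"
      by (simp add: sum_3 algebra_simps)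
    also have "\<dots> = R x"
      using strain_curl_pointwise[of "\<lambda>i j. weak_partial i (\<omega> j) x" ?q "\<lambda>i. w i x" "\<lambda>i. \<omega> i x"] elim(1,2)
      by (simp add: R_def E_def w_eq)
    finally show ?case ..
  qed
  have "R \<in> borel_measurable lborel" by (rule borel_measurable_has_bochner_integral[OF R])
  \<comment> \<open>Transporting the integral along equality almost everywhere requires both
    integrands to be measurable.\<close>
  moreover have "(\<lambda>x. (- laplacian S x) \<bullet> tensor (curl u x) (curl u x)) \<in> borel_measurable lborel"
  proof -
    have [measurable]: "\<omega> i \<in> borel_measurable borel" for i by (rule H1_measurable[OF H2_H1[OF \<omega>_H2]])
    have "weak_partial k (weak_partial k (\<lambda>x. S x $ i $ j)) \<in> borel_measurable borel" for i j k
      using H2_weak_partial_H1[OF S] by (simp add: H1_iff L2_def)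
    then have [measurable]: "(\<lambda>x. laplacian S x $ i $ j) \<in> borel_measurable borel" for i j
      by (simp add: laplacian_def)
    show ?thesis by (simp add: inner_vec_def tensor_def)
  qed
  ultimately show ?thesis
    using R ae has_bochner_integral_cong_AE by blast
qed

end

theorem theorem1p3:
  fixes S :: "real^3 \<Rightarrow> real^3^3" and u \<omega> :: "real^3 \<Rightarrow> real^3"
  assumes "S \<in> H2_st"
    and "u \<in> Hdot1_df"
    and "AE x in lborel. S x = sym_grad u x"
    and "\<omega> = curl u"
  shows "integrable lborel (\<lambda>x. (- laplacian S x) \<bullet> tensor (\<omega> x) (\<omega> x)) \<and>
         L2_inner (\<lambda>x. - laplacian S x) (\<lambda>x. tensor (\<omega> x) (\<omega> x)) = 0"
proof -
  interpret velocity_strain u S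
    by unfold_locales (use assms in \<open>auto simp: H2_st_def Hdot1_df_def Hdot1_def\<close>)
  \<comment> \<open>A Bochner integral is 0 by convention when the integrand is not integrable;
    \<open>has_bochner_integral\<close> includes integrability, so the value 0 is a genuine
    one.\<close>
  show ?thesis
    using strain_laplacian_integral assms(4)
    by (simp add: has_bochner_integral_iff L2_inner_def)
qed

end
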